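(* Let $0\le s<1$. Let $m,n\in\mathbb{N}$ and let $\Phi: M_m(\mathbb{C})\to M_n(\mathbb{C})$ be any sesquiunital Schwarz map. Then for all $A\in M_n^{++}(\mathbb{C})$, all invertible $B\in M_n(\mathbb{C})$, and all $q$ with $$\frac{1}{2-s}\le q<1,$$ we have $$\left(\frac{n}{m}\right)^{(2-s)q-1}\operatorname{Tr}\left[\left(B^*A^{-s}B\right)^{q}\right]\ge \operatorname{Tr}\left[\left(\Phi^\dagger(B)^*\,\Phi^\dagger(A)^{-s}\,\Phi^\dagger(B)\right)^{q}\right].$$
   Context: $M_n(\mathbb{C})$ denotes the $n\times n$ complex matrices and $M_n^{++}(\mathbb{C})$ the open cone of positive definite matrices in $M_n(\mathbb{C})$; $\mathbf{1}$ is the identity matrix. Each $M_n(\mathbb{C})$ carries the Hilbert–Schmidt inner product $\langle X,Y\rangle=\operatorname{Tr}[X^*Y]$, and $\Phi^\dagger: M_n(\mathbb{C})\to M_m(\mathbb{C})$ is the adjoint of $\Phi$ with respect to these inner products. A Schwarz map is a linear map $\Phi: M_m(\mathbb{C})\to M_n(\mathbb{C})$ such that $\Phi(X^*X)\ge \Phi(X)^*\Phi(X)$ for all $X\in M_m(\mathbb{C})$. A linear map $\Phi: M_m(\mathbb{C})\to M_n(\mathbb{C})$ is unital if $\Phi(\mathbf{1})=\mathbf{1}$, semiunital if $\Phi^\dagger(\mathbf{1})=\frac{n}{m}\mathbf{1}$, and sesquiunital if it is both unital and semiunital. *)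

theory Defs
  imports "HOL-Analysis.Analysis" "HOL-Library.Complex_Order"
begin

type_synonym 'n cmat = "complex ^ 'n ^ 'n"

(* The scalar action of \<complex> on matrices; the library's *\<^sub>R on this type is only the real one. *)
definition cscale :: "complex \<Rightarrow> 'n::finite cmat \<Rightarrow> 'n cmat" where
  "cscale c X = (\<chi> i j. c * X $ i $ j)"

lemma vector_space_cscale: "vector_space (cscale :: complex \<Rightarrow> 'n::finite cmat \<Rightarrow> 'n cmat)"
  by unfold_locales (simp_all add: cscale_def vec_eq_iff algebra_simps)

abbreviation clinear :: "('m::finite cmat \<Rightarrow> 'n::finite cmat) \<Rightarrow> bool" where
  "clinear \<equiv> Vector_Spaces.linear cscale cscale"

definition ctranspose :: "'n::finite cmat \<Rightarrow> 'n cmat" where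
  "ctranspose X = (\<chi> i j. cnj (X $ j $ i))"

definition cinner :: "complex ^ 'n::finite \<Rightarrow> complex ^ 'n \<Rightarrow> complex" where
  "cinner x y = (\<Sum>i\<in>UNIV. cnj (x $ i) * y $ i)"

(* The orders below are those of HOL-Library.Complex_Order: 0 \<le> z means that z is real and
   nonnegative.  Hence these matrices are automatically Hermitian. *)
definition pos_semidef :: "'n::finite cmat \<Rightarrow> bool" where
  "pos_semidef X \<longleftrightarrow> (\<forall>x. 0 \<le> cinner x (X *v x))"

definition pos_def :: "'n::finite cmat \<Rightarrow> bool" where
  "pos_def X \<longleftrightarrow> (\<forall>x. x \<noteq> 0 \<longrightarrow> 0 < cinner x (X *v x))"

definition loewner_le :: "'n::finite cmat \<Rightarrow> 'n cmat \<Rightarrow> bool" where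
  "loewner_le X Y \<longleftrightarrow> pos_semidef (Y - X)"

definition unitary :: "'n::finite cmat \<Rightarrow> bool" where
  "unitary U \<longleftrightarrow> ctranspose U ** U = mat 1 \<and> U ** ctranspose U = mat 1"

definition real_diag :: "('n::finite \<Rightarrow> real) \<Rightarrow> 'n cmat" where
  "real_diag d = (\<chi> i j. if i = j then complex_of_real (d i) else 0)"

(* Real powers by functional calculus, for a positive semidefinite X (the value is unspecified
   otherwise).  Since 0 powr p = 0, this is the usual X^p for every p > 0; for p \<le> 0 it
   is the usual one when X is positive definite. *)
definition mat_powr :: "'n::finite cmat \<Rightarrow> real \<Rightarrow> 'n cmat" where
  "mat_powr X p = (THE Y. \<exists>U d. unitary U \<and> (\<forall>i. 0 \<le> d i) \<and>
     X = U ** real_diag d ** ctranspose U \<and>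
     Y = U ** real_diag (\<lambda>i. d i powr p) ** ctranspose U)"

definition hs_inner :: "'n::finite cmat \<Rightarrow> 'n cmat \<Rightarrow> complex" where
  "hs_inner X Y = trace (ctranspose X ** Y)"

definition hs_adjoint :: "('m::finite cmat \<Rightarrow> 'n::finite cmat) \<Rightarrow> 'n cmat \<Rightarrow> 'm cmat" where
  "hs_adjoint \<Phi> = (THE \<Psi>. \<forall>X Y. hs_inner (\<Psi> Y) X = hs_inner Y (\<Phi> X))"

definition schwarz_map :: "('m::finite cmat \<Rightarrow> 'n::finite cmat) \<Rightarrow> bool" where
  "schwarz_map \<Phi> \<longleftrightarrow> clinear \<Phi> \<and>
     (\<forall>X. loewner_le (ctranspose (\<Phi> X) ** \<Phi> X) (\<Phi> (ctranspose X ** X)))"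

definition unital :: "('m::finite cmat \<Rightarrow> 'n::finite cmat) \<Rightarrow> bool" where
  "unital \<Phi> \<longleftrightarrow> \<Phi> (mat 1) = mat 1"

definition semiunital :: "('m::finite cmat \<Rightarrow> 'n::finite cmat) \<Rightarrow> bool" where
  "semiunital \<Phi> \<longleftrightarrow>
     hs_adjoint \<Phi> (mat 1) = cscale (of_nat CARD('n) / of_nat CARD('m)) (mat 1)"

definition sesquiunital :: "('m::finite cmat \<Rightarrow> 'n::finite cmat) \<Rightarrow> bool" where
  "sesquiunital \<Phi> \<longleftrightarrow> unital \<Phi> \<and> semiunital \<Phi>"

text \<open>The two definite descriptions are justified: the adjoint exists and is unique, and the
  power does not depend on the chosen spectral decomposition (which exists for positive
  semidefinite matrices by the spectral theorem).\<close>

lemma hs_inner_sum: "hs_inner X Y = (\<Sum>i\<in>UNIV. \<Sum>j\<in>UNIV. cnj (X $ i $ j) * Y $ i $ j)"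
  unfolding hs_inner_def trace_def ctranspose_def matrix_matrix_mult_def
  by simp (rule sum.swap)

lemma hs_adjoint_unique:
  assumes "\<And>X Y. hs_inner (\<Psi> Y) X = hs_inner Y (\<Phi> X)"
    and "\<And>X Y. hs_inner (\<Psi>' Y) X = hs_inner Y (\<Phi> X)"
  shows "\<Psi> = \<Psi>'"
proof
  fix Y
  have eq: "hs_inner (\<Psi> Y) X = hs_inner (\<Psi>' Y) X" for X
    using assms by simp
  show "\<Psi> Y = \<Psi>' Y"
  proof -
    have "\<Psi> Y $ k $ l = \<Psi>' Y $ k $ l" for k l
    proof -
      have pick: "hs_inner Z (\<chi> i j. if i = k \<and> j = l then 1 else 0) = cnj (Z $ k $ l)" for Z
      proof -
        have "(\<Sum>j\<in>UNIV. cnj (Z $ i $ j) * (if i = k \<and> j = l then 1 else 0))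
            = (if i = k then cnj (Z $ k $ l) else 0)" for i
          by (cases "i = k") (simp_all add: if_distrib cong: if_cong)
        then show ?thesis by (simp add: hs_inner_sum)
      qed
      show ?thesis
        using eq[of "\<chi> i j. if i = k \<and> j = l then 1 else 0"] by (simp add: pick)
    qed
    then show ?thesis by (simp add: vec_eq_iff)
  qed
qed

lemma hs_adjoint:
  fixes \<Phi> :: "'m::finite cmat \<Rightarrow> 'n::finite cmat"
  assumes "clinear \<Phi>"
  shows "hs_inner (hs_adjoint \<Phi> Y) X = hs_inner Y (\<Phi> X)"
proof -
  interpret Vector_Spaces.linear "cscale :: _ \<Rightarrow> 'm cmat \<Rightarrow> _" "cscale :: _ \<Rightarrow> 'n cmat \<Rightarrow> _" \<Phi>
    by (fact assms)
  define E :: "'m \<Rightarrow> 'm \<Rightarrow> 'm cmat"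
    where "E k l = (\<chi> i j. if i = k \<and> j = l then 1 else 0)" for k l
  define \<Psi> where "\<Psi> Y = (\<chi> i j. cnj (hs_inner Y (\<Phi> (E i j))))" for Y
  have expand: "X = (\<Sum>k\<in>UNIV. \<Sum>l\<in>UNIV. cscale (X $ k $ l) (E k l))" for X
  proof -
    have "(\<Sum>l\<in>UNIV. X $ k $ l * (if i = k \<and> j = l then 1 else 0))
        = (if i = k then X $ k $ j else 0)" for i j k
      by (cases "i = k") (simp_all add: if_distrib cong: if_cong)
    then show ?thesis by (simp add: vec_eq_iff cscale_def E_def)
  qed
  have hs_sum: "hs_inner Y (\<Sum>k\<in>S. F k) = (\<Sum>k\<in>S. hs_inner Y (F k))" 
    for Y :: "'n cmat" and F and S :: "'m set"
    by (induction S rule: infinite_finite_induct)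
       (simp_all add: hs_inner_sum distrib_left sum.distrib)
  have hs_scale: "hs_inner Y (cscale c Z) = c * hs_inner Y Z" for Y Z :: "'n cmat" and c
    by (simp add: hs_inner_sum cscale_def sum_distrib_left mult_ac)
  have adj: "hs_inner (\<Psi> Y) X = hs_inner Y (\<Phi> X)" for X Y
  proof -
    have "\<Phi> X = (\<Sum>k\<in>UNIV. \<Sum>l\<in>UNIV. cscale (X $ k $ l) (\<Phi> (E k l)))"
      by (subst expand) (simp add: sum scale)
    then have "hs_inner Y (\<Phi> X) = (\<Sum>k\<in>UNIV. \<Sum>l\<in>UNIV. X $ k $ l * hs_inner Y (\<Phi> (E k l)))"
      by (simp add: hs_sum hs_scale)
    then show ?thesis
      unfolding hs_inner_sum[of "\<Psi> Y"] by (simp add: \<Psi>_def mult.commute)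
  qed
  have "hs_adjoint \<Phi> = \<Psi>"
    unfolding hs_adjoint_def
  proof (rule the_equality)
    show "\<forall>X Y. hs_inner (\<Psi> Y) X = hs_inner Y (\<Phi> X)" by (simp add: adj)
    show "\<Psi>' = \<Psi>" if "\<forall>X Y. hs_inner (\<Psi>' Y) X = hs_inner Y (\<Phi> X)" for \<Psi>'
      by (rule hs_adjoint_unique[of _ \<Phi>]) (simp_all add: that adj)
  qed
  then show ?thesis by (simp add: adj)
qed

lemma real_diag_mult_left: "(real_diag d ** X) $ i $ j = d i * X $ i $ j"
proof -
  have "(real_diag d ** X) $ i $ j = (\<Sum>k\<in>UNIV. if i = k then d i * X $ k $ j else 0)"
    unfolding matrix_matrix_mult_def real_diag_def vec_lambda_beta by (rule sum.cong) auto
  then show ?thesis by simp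
qed

lemma real_diag_mult_right: "(X ** real_diag d) $ i $ j = X $ i $ j * d j"
proof -
  have "(X ** real_diag d) $ i $ j = (\<Sum>k\<in>UNIV. if k = j then X $ i $ k * d k else 0)"
    unfolding matrix_matrix_mult_def real_diag_def vec_lambda_beta by (rule sum.cong) auto
  then show ?thesis by simp
qed

lemma functional_calculus_unique:
  assumes U: "unitary U" and V: "unitary V"
    and eq: "U ** real_diag d ** ctranspose U = V ** real_diag e ** ctranspose V"
  shows "U ** real_diag (\<lambda>i. f (d i)) ** ctranspose U = V ** real_diag (\<lambda>i. f (e i)) ** ctranspose V"
proof -
  define W where "W = ctranspose V ** U"
  have V1: "ctranspose V ** V = mat 1" "V ** ctranspose V = mat 1"
    and U1: "ctranspose U ** U = mat 1" "U ** ctranspose U = mat 1"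
    using U V by (auto simp: unitary_def)
  have "ctranspose V ** (U ** real_diag d ** ctranspose U) ** U
      = ctranspose V ** (V ** real_diag e ** ctranspose V) ** U"
    by (simp add: eq)
  moreover have "ctranspose V ** (U ** real_diag d ** ctranspose U) ** U
      = W ** real_diag d ** (ctranspose U ** U)"
    by (simp add: W_def matrix_mul_assoc)
  moreover have "ctranspose V ** (V ** real_diag e ** ctranspose V) ** U
      = (ctranspose V ** V) ** real_diag e ** W"
    by (simp add: W_def matrix_mul_assoc)
  ultimately have "W ** real_diag d = real_diag e ** W"
    by (simp add: U1 V1)
  then have "W $ i $ j * d j = e i * W $ i $ j" for i j
    by (metis real_diag_mult_left real_diag_mult_right)
  then have "W $ i $ j = 0 \<or> d j = e i" for i j
    by (metis mult.commute mult_cancel_left of_real_eq_iff)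
  then have "W $ i $ j * f (d j) = f (e i) * W $ i $ j" for i j
    by (metis mult.commute mult_zero_left)
  then have W: "W ** real_diag (\<lambda>i. f (d i)) = real_diag (\<lambda>i. f (e i)) ** W"
    by (simp add: vec_eq_iff real_diag_mult_left real_diag_mult_right)
  have "U ** real_diag (\<lambda>i. f (d i)) ** ctranspose U
      = V ** (W ** real_diag (\<lambda>i. f (d i))) ** ctranspose U"
    by (simp add: W_def matrix_mul_assoc V1)
  also have "\<dots> = V ** real_diag (\<lambda>i. f (e i)) ** ctranspose V ** (U ** ctranspose U)"
    unfolding W by (simp add: W_def matrix_mul_assoc)
  finally show ?thesis by (simp add: U1)
qed

lemma mat_powr_spectral:
  assumes "unitary U" and "\<And>i. 0 \<le> d i"
  shows "mat_powr (U ** real_diag d ** ctranspose U) p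
       = U ** real_diag (\<lambda>i. d i powr p) ** ctranspose U"
  unfolding mat_powr_def
proof (rule the_equality)
  show "\<exists>V e. unitary V \<and> (\<forall>i. 0 \<le> e i) \<and>
      U ** real_diag d ** ctranspose U = V ** real_diag e ** ctranspose V \<and>
      U ** real_diag (\<lambda>i. d i powr p) ** ctranspose U
        = V ** real_diag (\<lambda>i. e i powr p) ** ctranspose V"
    using assms by blast
qed (use assms functional_calculus_unique[where f = "\<lambda>x. x powr p"] in metis)

end

theory Submission
  imports Defs
begin

text \<open>
  Write \<open>\<Psi>\<close> for the adjoint of \<open>\<Phi>\<close>, \<open>\<kappa> = n/m\<close> and \<open>r = (1 - q) / q\<close>; the hypothesis
  \<open>1 / (2 - s) \<le> q\<close> says exactly that \<open>s + r \<le> 1\<close>. Put \<open>X = B\<^sup>* A\<^sup>-\<^sup>s B\<close> and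
  \<open>X' = \<Psi>(B)\<^sup>* \<Psi>(A)\<^sup>-\<^sup>s \<Psi>(B)\<close>.

  By Young's inequality, \<open>Tr X'\<^sup>q \<le> q Tr (X' Y\<^sup>-\<^sup>r) + (1 - q) Tr Y\<close> for every positive definite
  \<open>Y\<close> (\<open>trace_powr_variational\<close>), with equality at \<open>Y = X'\<^sup>q\<close> if \<open>X'\<close> is invertible. This replaces the power \<open>q\<close> of a
  product by an expression of Lieb's type, in which \<open>\<Psi>\<close> can be controlled, and a choice \<open>Y = \<Psi>(Z)\<close>
  is enough. With \<open>c = \<kappa> powr (1 - s - r)\<close>, the monotonicity estimate

    \<open>Tr (\<Psi>(B)\<^sup>* \<Psi>(A)\<^sup>-\<^sup>s \<Psi>(B) \<Psi>(Z)\<^sup>-\<^sup>r) \<le> c Tr (B\<^sup>* A\<^sup>-\<^sup>s B Z\<^sup>-\<^sup>r)\<close>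

  (\<open>hs_adjoint_trace_le\<close>) and \<open>Tr \<Psi>(Z) = Tr Z\<close>, which holds as \<open>\<Phi>\<close> is unital, bound \<open>Tr X'\<^sup>q\<close> by
  \<open>q c Tr (X Z\<^sup>-\<^sup>r) + (1 - q) Tr Z\<close>. For the multiple \<open>Z = c\<^sup>q X\<^sup>q\<close> of the optimiser for \<open>X\<close> this
  is \<open>c\<^sup>q Tr X\<^sup>q\<close>, and \<open>c\<^sup>q\<close> is the constant of the theorem.

  The monotonicity estimate is dual to
  \<open>Tr (\<Phi>(Y)\<^sup>* A\<^sup>s \<Phi>(Y) Z\<^sup>r) \<le> c Tr (Y\<^sup>* \<Psi>(A)\<^sup>s Y \<Psi>(Z)\<^sup>r)\<close>. The three vertices \<open>(0,0)\<close>, \<open>(1,0)\<close>,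
  \<open>(0,1)\<close> of the triangle of exponents \<open>(s,r)\<close> follow from the Schwarz inequality for \<open>Y\<close> and for
  \<open>Y\<^sup>*\<close>; semiunitality enters at \<open>(0,0)\<close>. In eigenbases of the four positive matrices both sides
  become weighted sums of squares, with weights \<open>a\<^sub>i\<^sup>s z\<^sub>j\<^sup>r\<close>, so the interior of the triangle follows
  from two applications of interpolation of an additive map between weighted \<open>\<ell>\<^sup>2\<close> norms
  (\<open>weighted_interpolation\<close>). That interpolation is elementary: the infimum of
  \<open>p |v|\<^sup>2 + r |w|\<^sup>2\<close> over \<open>v + w = x\<close> is the parallel sum \<open>p r / (p + r)\<close> times \<open>|x|\<^sup>2\<close>, whence
  bounds for two weights pass to their parallel sum, and a weighted geometric mean is an integral
  of parallel sums.
\<close>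

section \<open>The conjugate transpose and the inner product\<close>

lemma ctranspose_nth [simp]: "ctranspose X $ i $ j = cnj (X $ j $ i)"
  by (simp add: ctranspose_def)

lemma ctranspose_ctranspose [simp]: "ctranspose (ctranspose X) = X"
  by (simp add: vec_eq_iff)

lemma ctranspose_mult: "ctranspose (X ** Y) = ctranspose Y ** ctranspose X"
  by (simp add: vec_eq_iff matrix_matrix_mult_def mult.commute)

lemma ctranspose_mat_1 [simp]: "ctranspose (mat 1) = mat 1"
  by (simp add: vec_eq_iff mat_def)

lemma ctranspose_real_diag [simp]: "ctranspose (real_diag d) = real_diag d"
  by (simp add: vec_eq_iff real_diag_def)

lemma real_diag_1: "real_diag (\<lambda>_. 1) = mat 1"
  by (simp add: vec_eq_iff real_diag_def mat_def)

lemma cinner_add_left: "cinner (x + y) z = cinner x z + cinner y z"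
  by (simp add: cinner_def distrib_right sum.distrib)

lemma cinner_add_right: "cinner x (y + z) = cinner x y + cinner x z"
  by (simp add: cinner_def distrib_left sum.distrib)

lemma cinner_scale_left: "cinner (c *s x) y = cnj c * cinner x y"
  by (simp add: cinner_def sum_distrib_left mult_ac)

lemma cinner_scale_right: "cinner x (c *s y) = c * cinner x y"
  by (simp add: cinner_def sum_distrib_left mult_ac)

lemma cinner_diff_left: "cinner (x - y) z = cinner x z - cinner y z"
  by (simp add: cinner_def left_diff_distrib sum_subtractf)

lemma cinner_diff_right: "cinner x (y - z) = cinner x y - cinner x z"
  by (simp add: cinner_def right_diff_distrib sum_subtractf)

lemmas cinner_sesquilinear =
  cinner_add_left cinner_add_right cinner_diff_left cinner_diff_right cinner_scale_left cinner_scale_right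

lemma cinner_matrix_left: "cinner (X *v x) y = cinner x (ctranspose X *v y)"
  by (simp add: cinner_def matrix_vector_mult_def sum_distrib_left sum_distrib_right mult_ac)
     (rule sum.swap)

lemma cinner_axis: "cinner (axis i 1) x = x $ i"
  by (simp add: cinner_def axis_def if_distrib if_distribR cong: if_cong)

lemma cinner_axis_matrix: "cinner (axis i 1) (X *v axis j 1) = X $ i $ j"
  unfolding cinner_axis by (simp add: matrix_vector_mult_def axis_def if_distrib cong: if_cong)

lemma conjugate_nth:
  "(ctranspose U ** X ** V) $ i $ j = cinner (column i U) (X *v column j V)"
proof -
  have "(ctranspose U ** X ** V) $ i $ j = (\<Sum>l\<in>UNIV. \<Sum>k\<in>UNIV. cnj (U $ k $ i) * X $ k $ l * V $ l $ j)"
    by (simp add: matrix_matrix_mult_def sum_distrib_right)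
  also have "\<dots> = (\<Sum>k\<in>UNIV. \<Sum>l\<in>UNIV. cnj (U $ k $ i) * X $ k $ l * V $ l $ j)"
    by (rule sum.swap)
  finally show ?thesis
    by (simp add: cinner_def matrix_vector_mult_def column_def sum_distrib_left mult.assoc)
qed

lemma gram_nth: "(ctranspose U ** V) $ i $ j = cinner (column i U) (column j V)"
  using conjugate_nth[of U "mat 1" V i j] by simp

lemma cinner_self: "cinner x x = complex_of_real (\<Sum>i\<in>UNIV. (cmod (x $ i))\<^sup>2)"
  unfolding cinner_def of_real_sum complex_norm_square by (simp add: mult.commute)

lemma cinner_self_pos: "x \<noteq> 0 \<Longrightarrow> 0 < cinner x x"
proof -
  assume "x \<noteq> 0"
  then obtain i where "x $ i \<noteq> 0" by (auto simp: vec_eq_iff)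
  then have "0 < (\<Sum>i\<in>UNIV. (cmod (x $ i))\<^sup>2)"
    by (intro sum_pos2[where i = i]) auto
  then show ?thesis by (simp add: cinner_self less_complex_def)
qed

lemma unitaryI: "ctranspose U ** U = mat 1 \<Longrightarrow> unitary U"
  by (simp add: unitary_def matrix_left_right_inverse)

lemma unitary_mult: "unitary U \<Longrightarrow> unitary V \<Longrightarrow> unitary (U ** V)"
  by (rule unitaryI)
    (metis (no_types, lifting) ctranspose_mult matrix_mul_assoc matrix_mul_lid unitary_def)

lemma pos_def_imp_pos_semidef: "pos_def X \<Longrightarrow> pos_semidef X"
  unfolding pos_def_def pos_semidef_def
  by (metis (mono_tags, lifting) cinner_self cinner_scale_left less_imp_le matrix_vector_mult_0_right
      mult_zero_left order_refl complex_cnj_zero vector_smult_lzero)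

lemma pos_semidef_conjugate: "pos_semidef P \<Longrightarrow> pos_semidef (ctranspose B ** P ** B)"
  using cinner_matrix_left[of "ctranspose (ctranspose B)"]
  by (simp add: pos_semidef_def matrix_vector_mul_assoc[symmetric] cinner_matrix_left[symmetric])

lemma pos_def_conjugate:
  assumes "pos_def P" "invertible B"
  shows "pos_def (ctranspose B ** P ** B)"
proof -
  obtain C where C: "C ** B = mat 1" using assms by (auto simp: invertible_def)
  have "B *v x \<noteq> 0" if "x \<noteq> 0" for x
    by (metis C matrix_vector_mul_assoc matrix_vector_mul_lid matrix_vector_mult_0_right that)
  then show ?thesis using assms
    by (simp add: pos_def_def matrix_vector_mul_assoc[symmetric] cinner_matrix_left[symmetric])
qed

lemma pos_semidef_gram: "pos_semidef (ctranspose X ** X)"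
proof -
  have "pos_semidef (mat 1 :: 'a::finite cmat)"
    by (simp add: pos_semidef_def cinner_self less_eq_complex_def sum_nonneg)
  from pos_semidef_conjugate[OF this, of X] show ?thesis by simp
qed

text \<open>
  A complex quadratic form determines its sesquilinear form by polarization; here it suffices to
  test it on \<open>e\<^sub>i\<close>, \<open>e\<^sub>j\<close>, \<open>e\<^sub>i + e\<^sub>j\<close> and \<open>e\<^sub>i + \<i> e\<^sub>j\<close>.
\<close>

lemma pos_semidef_hermitian:
  assumes "pos_semidef X"
  shows "ctranspose X = X"
proof -
  have im: "Im (cinner x (X *v x)) = 0" for x
    using assms by (simp add: pos_semidef_def less_eq_complex_def)
  have "cnj (X $ j $ i) = X $ i $ j" for i j
  proof -
    have "Im (X $ i $ i) = 0" "Im (X $ j $ j) = 0"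
      using im[of "axis i 1"] im[of "axis j 1"] by (simp_all add: cinner_axis_matrix)
    moreover have "Im (X $ i $ i + X $ i $ j + X $ j $ i + X $ j $ j) = 0"
      using im[of "axis i 1 + axis j 1"]
      by (simp add: cinner_sesquilinear matrix_vector_right_distrib cinner_axis_matrix)
    moreover have "Im (X $ i $ i + \<i> * X $ i $ j - \<i> * X $ j $ i + X $ j $ j) = 0"
      using im[of "axis i 1 + \<i> *s axis j 1"]
      by (simp add: cinner_sesquilinear matrix_vector_right_distrib cinner_axis_matrix
          vector_scalar_commute)
    ultimately show ?thesis by (simp add: complex_eq_iff)
  qed
  then show ?thesis by (simp add: vec_eq_iff)
qed

section \<open>The spectral theorem\<close>

lemma compact_unitary: "compact {U :: 'n::finite cmat. unitary U}"
proof -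
  have eq: "{U :: 'n cmat. unitary U} = {U. ctranspose U ** U = mat 1}"
    using unitaryI by (auto simp: unitary_def)
  have "closed {U :: 'n cmat. ctranspose U ** U = mat 1}"
    unfolding ctranspose_def matrix_matrix_mult_def
    by (intro closed_Collect_eq continuous_intros)
  moreover have "bounded {U :: 'n cmat. ctranspose U ** U = mat 1}"
  proof -
    have "norm U \<le> (\<Sum>i\<in>(UNIV :: 'n set). \<Sum>j\<in>(UNIV :: 'n set). 1)"
      if "ctranspose U ** U = mat 1" for U :: "'n cmat"
    proof -
      have "cmod (U $ i $ j) \<le> 1" for i j
      proof -
        have "(\<Sum>k\<in>UNIV. cnj (U $ k $ j) * U $ k $ j) = 1"
          using arg_cong[OF that, of "\<lambda>X. X $ j $ j"]
          by (simp add: matrix_matrix_mult_def mat_def)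
        then have "complex_of_real (\<Sum>k\<in>UNIV. (cmod (U $ k $ j))\<^sup>2) = 1"
            unfolding of_real_sum complex_norm_square by (simp add: mult.commute)
          then have "(\<Sum>k\<in>UNIV. (cmod (U $ k $ j))\<^sup>2) = 1"
          using of_real_eq_1_iff by blast
        moreover have "(cmod (U $ i $ j))\<^sup>2 \<le> (\<Sum>k\<in>UNIV. (cmod (U $ k $ j))\<^sup>2)"
          by (rule member_le_sum) auto
        ultimately show ?thesis by (simp add: power_le_one_iff abs_square_le_1)
      qed
      then have "norm (U $ i) \<le> (\<Sum>j\<in>(UNIV :: 'n set). 1)" for i
        unfolding norm_vec_def by (intro order_trans[OF L2_set_le_sum] sum_mono) auto
      then show ?thesis
        unfolding norm_vec_def[of U] by (intro order_trans[OF L2_set_le_sum] sum_mono) auto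
    qed
    then show ?thesis unfolding bounded_iff by blast
  qed
  ultimately show ?thesis by (simp add: eq compact_eq_bounded_closed)
qed


text \<open>
  Choose distinct weights \<open>w\<^sub>k\<close> and a unitary \<open>U\<close> that maximises the \<open>w\<close>-weighted sum of the
  diagonal entries of \<open>M = U\<^sup>* X U\<close>; it exists by compactness. Rotating the basis vectors \<open>i\<close> and \<open>j\<close>
  into each other by the angle \<open>\<theta>\<close>, with a phase \<open>\<omega>\<close> that makes \<open>\<omega> M\<^sub>i\<^sub>j\<close> nonnegative, changes this
  sum at first order by \<open>2 \<theta> (w\<^sub>i - w\<^sub>j) |M\<^sub>i\<^sub>j|\<close>. At a maximum this vanishes, so \<open>M\<^sub>i\<^sub>j = 0\<close>. Distinct
  weights matter: the plain trace is the same for all \<open>U\<close>.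
\<close>

lemma unitary_diagonalisation:
  fixes X :: "'n::finite cmat"
  assumes herm: "ctranspose X = X"
  obtains U where "unitary U" "\<And>i j. i \<noteq> j \<Longrightarrow> (ctranspose U ** X ** U) $ i $ j = 0"
proof -
  obtain w :: "'n \<Rightarrow> nat" where "inj w"
    using finite_imp_inj_to_nat_seg[of "UNIV :: 'n set"] by auto
  define g where "g U = (\<Sum>k\<in>UNIV. real (w k) * Re ((ctranspose U ** X ** U) $ k $ k))" for U :: "'n cmat"
  have "continuous_on {U. unitary U} g"
    unfolding g_def matrix_matrix_mult_def ctranspose_def
    by (intro continuous_intros)
  moreover have "(mat 1 :: 'n cmat) \<in> {U. unitary U}"
    by (simp add: unitary_def)
  ultimately obtain U where U: "unitary U" and max: "\<And>V. unitary V \<Longrightarrow> g V \<le> g U"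
    using continuous_attains_sup[OF compact_unitary, of g] by auto
  define M where "M = ctranspose U ** X ** U"
  have M_herm: "M $ l $ k = cnj (M $ k $ l)" for k l
  proof -
    have "ctranspose M = M" by (simp add: M_def ctranspose_mult herm matrix_mul_assoc)
    then show ?thesis by (metis ctranspose_nth)
  qed
  have "M $ i $ j = 0" if "i \<noteq> j" for i j
  proof (rule ccontr)
    assume nz: "M $ i $ j \<noteq> 0"
    define \<omega> where "\<omega> = cnj (sgn (M $ i $ j))"
    have \<omega>: "\<omega> * cnj \<omega> = 1" "cnj \<omega> * \<omega> = 1" 
      using nz by (simp_all add: \<omega>_def complex_norm_square[symmetric] norm_sgn mult.commute)
    have \<omega>l: "\<omega> * (cnj \<omega> * z) = z" for z
      by (metis \<omega>(1) mult.assoc mult_1)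
    have \<omega>M: "\<omega> * M $ i $ j = cmod (M $ i $ j)"
      using nz by (simp add: \<omega>_def sgn_div_norm scaleR_conv_of_real mult.commute
          complex_norm_square[symmetric] power2_eq_square divide_simps)
    then have \<omega>M': "cnj \<omega> * M $ j $ i = cmod (M $ i $ j)"
      by (metis M_herm complex_cnj_complex_of_real complex_cnj_mult)
    \<comment> \<open>The columns of the rotation with cosine \<open>c\<close> and sine \<open>s\<close> in the plane of the vectors \<open>i\<close> and \<open>j\<close>.\<close>
    define v where "v c s k = (if k = i then complex_of_real c *s axis i 1 + (of_real s * \<omega>) *s axis j 1
      else if k = j then (- of_real s * cnj \<omega>) *s axis i 1 + complex_of_real c *s axis j 1
      else axis k (1::complex))" for c s :: real and k
    define V where "V c s = (\<chi> a b. v c s b $ a)" for c s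
    have V_col: "column k (V c s) = v c s k" for c s k
      by (simp add: column_def V_def vec_eq_iff)
    have V: "unitary (V c s)" if cs: "c\<^sup>2 + s\<^sup>2 = 1" for c s
    proof (rule unitaryI)
      have cs': "complex_of_real c * of_real c + of_real s * of_real s = 1"
        using arg_cong[OF cs, of complex_of_real] by (simp add: power2_eq_square)
      have ax: "cinner (axis k 1) (axis l 1) = (if k = l then 1 else 0)" for k l :: 'n
        unfolding cinner_axis by (auto simp: axis_def)
      have "cinner (v c s k) (v c s l) = (if k = l then 1 else 0)" for k l
        using \<open>i \<noteq> j\<close> cs' \<omega>
        by (auto simp: v_def cinner_sesquilinear ax algebra_simps \<omega>l)
      then show "ctranspose (V c s) ** V c s = mat 1"
        by (simp add: vec_eq_iff gram_nth V_col mat_def)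
    qed
    have diag: "Re (cinner (v c s k) (M *v v c s k)) = Re (M $ k $ k) +
        (if k = i then s\<^sup>2 * (Re (M $ j $ j) - Re (M $ i $ i)) + 2 * c * s * cmod (M $ i $ j)
         else if k = j then - (s\<^sup>2 * (Re (M $ j $ j) - Re (M $ i $ i)) + 2 * c * s * cmod (M $ i $ j))
         else 0)" if cs: "c\<^sup>2 + s\<^sup>2 = 1" for c s k
    proof -
      have expand: "cinner (a *s axis i 1 + b *s axis j 1) (M *v (a *s axis i 1 + b *s axis j 1))
          = cnj a * a * M $ i $ i + cnj a * b * M $ i $ j + cnj b * a * M $ j $ i + cnj b * b * M $ j $ j" for a b
        by (simp add: matrix_vector_right_distrib vector_scalar_commute cinner_sesquilinear
            cinner_axis_matrix algebra_simps)
      have c2: "c\<^sup>2 = 1 - s\<^sup>2" using cs by simp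
      have eqi: "cinner (v c s i) (M *v v c s i) = of_real (c\<^sup>2) * M $ i $ i + of_real (c * s) * (\<omega> * M $ i $ j)
            + of_real (c * s) * (cnj \<omega> * M $ j $ i) + of_real (s\<^sup>2) * (cnj \<omega> * \<omega>) * M $ j $ j"
        by (simp add: v_def expand power2_eq_square)
      have i: "Re (cinner (v c s i) (M *v v c s i)) = Re (M $ i $ i)
            + (s\<^sup>2 * (Re (M $ j $ j) - Re (M $ i $ i)) + 2 * c * s * cmod (M $ i $ j))"
        unfolding eqi \<omega>M \<omega>M' \<omega> c2 by (simp add: algebra_simps)
      have "v c s j = (- of_real s * cnj \<omega>) *s axis i 1 + complex_of_real c *s axis j 1"
        using \<open>i \<noteq> j\<close> by (simp add: v_def)
      then have eqj: "cinner (v c s j) (M *v v c s j) = of_real (s\<^sup>2) * (\<omega> * cnj \<omega>) * M $ i $ i - of_real (c * s) * (\<omega> * M $ i $ j)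
            - of_real (c * s) * (cnj \<omega> * M $ j $ i) + of_real (c\<^sup>2) * M $ j $ j"
        using expand[of "- of_real s * cnj \<omega>" "of_real c"] by (simp add: power2_eq_square mult_ac)
      have j: "Re (cinner (v c s j) (M *v v c s j)) = Re (M $ j $ j)
            - (s\<^sup>2 * (Re (M $ j $ j) - Re (M $ i $ i)) + 2 * c * s * cmod (M $ i $ j))"
        unfolding eqj \<omega>M \<omega>M' \<omega> c2 by (simp add: algebra_simps)
      have "cinner (v c s k) (M *v v c s k) = M $ k $ k" if "k \<noteq> i" "k \<noteq> j"
        using that by (simp add: v_def cinner_axis_matrix)
      then show ?thesis using i j \<open>i \<noteq> j\<close> by auto
    qed
    \<comment> \<open>The change of the weighted diagonal sum under the rotation by \<open>\<theta>\<close>.\<close>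
    define h where "h \<theta> = (real (w i) - real (w j)) * ((sin \<theta>)\<^sup>2 * (Re (M $ j $ j) - Re (M $ i $ i))
         + 2 * cos \<theta> * sin \<theta> * cmod (M $ i $ j))" for \<theta>
    have "h \<theta> \<le> 0" for \<theta>
    proof -
      define D where "D = (sin \<theta>)\<^sup>2 * (Re (M $ j $ j) - Re (M $ i $ i)) + 2 * cos \<theta> * sin \<theta> * cmod (M $ i $ j)"
      let ?V = "V (cos \<theta>) (sin \<theta>)"
      have "ctranspose (U ** ?V) ** X ** (U ** ?V) = ctranspose ?V ** M ** ?V"
        by (simp add: M_def ctranspose_mult matrix_mul_assoc)
      then have "g (U ** ?V) = (\<Sum>k\<in>UNIV. real (w k) * Re ((ctranspose ?V ** M ** ?V) $ k $ k))"
        by (simp add: g_def)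
      also have "\<dots> = (\<Sum>k\<in>UNIV. real (w k) * Re (M $ k $ k) + 
          ((if k = i then real (w k) * D else 0) + (if k = j then - real (w k) * D else 0)))"
        unfolding conjugate_nth V_col diag[OF sin_cos_squared_add2] D_def[symmetric]
        using \<open>i \<noteq> j\<close> by (intro sum.cong) (auto simp: algebra_simps)
      also have "\<dots> = g U + h \<theta>"
        unfolding sum.distrib h_def g_def M_def[symmetric] D_def[symmetric]
        by (simp add: algebra_simps)
      finally show ?thesis using max[OF unitary_mult[OF U V[OF sin_cos_squared_add2]], of \<theta>] by simp
    qed
    moreover have "h 0 = 0" by (simp add: h_def)
    moreover have "(h has_real_derivative (real (w i) - real (w j)) * (2 * cmod (M $ i $ j))) (at 0)"
      unfolding h_def by (auto intro!: derivative_eq_intros)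
    ultimately have "(real (w i) - real (w j)) * (2 * cmod (M $ i $ j)) = 0"
      by (intro DERIV_local_max[of h _ 0 1]) auto
    then show False
      using nz \<open>inj w\<close> \<open>i \<noteq> j\<close> by (simp add: inj_eq)
  qed
  then show ?thesis using that U M_def by blast
qed

lemma pos_semidef_spectral:
  fixes X :: "'n::finite cmat"
  assumes "pos_semidef X"
  obtains U d where "unitary U" "\<And>i. 0 \<le> d i" "X = U ** real_diag d ** ctranspose U"
proof -
  obtain U where U: "unitary U"
    and off: "\<And>i j. i \<noteq> j \<Longrightarrow> (ctranspose U ** X ** U) $ i $ j = 0"
    using unitary_diagonalisation[OF pos_semidef_hermitian[OF assms]] by blast
  define d where "d i = Re ((ctranspose U ** X ** U) $ i $ i)" for i
  have nonneg: "0 \<le> (ctranspose U ** X ** U) $ i $ i" for i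
    using assms by (simp add: conjugate_nth pos_semidef_def)
  have "(ctranspose U ** X ** U) $ i $ j = real_diag d $ i $ j" for i j
    using off[of i j] nonneg[of i]
    by (auto simp: real_diag_def d_def complex_eq_iff less_eq_complex_def)
  then have "real_diag d = ctranspose U ** X ** U" by (simp add: vec_eq_iff)
  then have "U ** real_diag d ** ctranspose U = (U ** ctranspose U) ** X ** (U ** ctranspose U)"
    by (simp add: matrix_mul_assoc)
  then have "X = U ** real_diag d ** ctranspose U"
    using U by (simp add: unitary_def)
  moreover have "0 \<le> d i" for i
    using nonneg[of i] by (simp add: d_def less_eq_complex_def)
  ultimately show ?thesis using that U by blast
qed

lemma spectral_eigenvalue:
  assumes "unitary U" "X = U ** real_diag d ** ctranspose U"
  shows "cinner (column i U) (X *v column i U) = d i"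
proof -
  have "ctranspose U ** X ** U = (ctranspose U ** U) ** real_diag d ** (ctranspose U ** U)"
    by (simp add: assms(2) matrix_mul_assoc)
  then have "ctranspose U ** X ** U = real_diag d"
    using assms(1) by (simp add: unitary_def)
  then show ?thesis
    using conjugate_nth[of U X U i i] by (simp add: real_diag_def)
qed

lemma pos_def_spectral:
  fixes X :: "'n::finite cmat"
  assumes "pos_def X"
  obtains U d where "unitary U" "\<And>i. 0 < d i" "X = U ** real_diag d ** ctranspose U"
proof -
  obtain U d where U: "unitary U" and X: "X = U ** real_diag d ** ctranspose U"
    using pos_semidef_spectral[OF pos_def_imp_pos_semidef[OF assms]] by blast
  have "0 < d i" for i
  proof -
    have "cinner (column i U) (column i U) = 1"
      using gram_nth[of U U i i] U by (simp add: unitary_def mat_def)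
    then have "column i U \<noteq> 0" by (auto simp: cinner_def)
    then have "0 < cinner (column i U) (X *v column i U)"
      using assms by (simp add: pos_def_def)
    then show ?thesis
      unfolding spectral_eigenvalue[OF U X] by (simp add: less_complex_def)
  qed
  then show ?thesis using that U X by blast
qed

lemma pos_def_of_spectral:
  assumes U: "unitary U" and d: "\<And>i. 0 < d i"
  shows "pos_def (U ** real_diag d ** ctranspose U)"
  unfolding pos_def_def
proof (intro allI impI)
  fix x :: "complex ^ 'a" assume "x \<noteq> 0"
  define y where "y = ctranspose U *v x"
  have "U *v y = x"
    using U by (simp add: y_def matrix_vector_mul_assoc unitary_def)
  then obtain i where "y $ i \<noteq> 0"
    using \<open>x \<noteq> 0\<close> by (metis matrix_vector_mult_0_right vec_eq_iff zero_index)
  then have "0 < (\<Sum>i\<in>UNIV. d i * (cmod (y $ i))\<^sup>2)"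
    using d by (intro sum_pos2[where i = i]) (auto simp: less_imp_le)
  moreover have "real_diag d *v y = (\<chi> i. d i * y $ i)"
    by (simp add: vec_eq_iff matrix_vector_mult_def real_diag_def if_distrib if_distribR cong: if_cong)
  then have "cinner y (real_diag d *v y) = (\<Sum>i\<in>UNIV. d i * (cmod (y $ i))\<^sup>2)"
    unfolding of_real_sum of_real_mult complex_norm_square by (simp add: cinner_def mult_ac)
  moreover have "cinner x ((U ** real_diag d ** ctranspose U) *v x) = cinner y (real_diag d *v y)"
    by (simp add: y_def cinner_matrix_left matrix_vector_mul_assoc matrix_mul_assoc)
  ultimately show "0 < cinner x ((U ** real_diag d ** ctranspose U) *v x)"
    by (simp add: less_complex_def)
qed

section \<open>Interpolation between weighted square norms\<close>

text \<open>
  The difference of the two sides, multiplied by \<open>p + r\<close>, is at least \<open>(p |v| - r |w|)\<^sup>2\<close>. The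
  parallel sum is the best constant, attained when \<open>p v = r w\<close>.
\<close>

lemma parallel_sum_le:
  fixes v w :: complex and p r :: real
  assumes "0 < p" "0 < r"
  shows "p * r / (p + r) * (cmod (v + w))\<^sup>2 \<le> p * (cmod v)\<^sup>2 + r * (cmod w)\<^sup>2"
proof -
  have "(cmod (v + w))\<^sup>2 \<le> (cmod v + cmod w)\<^sup>2"
    by (intro power_mono norm_triangle_ineq norm_ge_zero)
  then have "p * r * (cmod (v + w))\<^sup>2 \<le> p * r * (cmod v + cmod w)\<^sup>2"
    using assms by (intro mult_left_mono) auto
  also have "\<dots> \<le> p * r * (cmod v + cmod w)\<^sup>2 + (p * cmod v - r * cmod w)\<^sup>2"
    by simp
  also have "\<dots> = (p + r) * (p * (cmod v)\<^sup>2 + r * (cmod w)\<^sup>2)"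
    by algebra
  finally show ?thesis
    using assms by (simp add: divide_le_eq mult.commute)
qed

text \<open>
  Split \<open>x = y + z\<close> coordinatewise in the ratio \<open>q1 : q0\<close>, which is optimal for the right-hand side,
  and estimate \<open>T x = T y + T z\<close> with the first bound on \<open>y\<close> and the second on \<open>z\<close>.
\<close>

lemma parallel_sum_weights:
  fixes T :: "('b::finite \<Rightarrow> complex) \<Rightarrow> ('a::finite \<Rightarrow> complex)"
  assumes add: "\<And>x y a. T (\<lambda>b. x b + y b) a = T x a + T y a"
    and pos: "\<And>a. 0 < p0 a" "\<And>a. 0 < p1 a" "\<And>b. 0 < q0 b" "\<And>b. 0 < q1 b"
    and bd0: "\<And>x. (\<Sum>a\<in>UNIV. p0 a * (cmod (T x a))\<^sup>2) \<le> (\<Sum>b\<in>UNIV. q0 b * (cmod (x b))\<^sup>2)"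
    and bd1: "\<And>x. (\<Sum>a\<in>UNIV. p1 a * (cmod (T x a))\<^sup>2) \<le> (\<Sum>b\<in>UNIV. q1 b * (cmod (x b))\<^sup>2)"
  shows "(\<Sum>a\<in>UNIV. p0 a * p1 a / (p0 a + p1 a) * (cmod (T x a))\<^sup>2)
       \<le> (\<Sum>b\<in>UNIV. q0 b * q1 b / (q0 b + q1 b) * (cmod (x b))\<^sup>2)"
proof -
  define y where "y b = of_real (q1 b / (q0 b + q1 b)) * x b" for b
  define z where "z b = of_real (q0 b / (q0 b + q1 b)) * x b" for b
  have ne: "q0 b + q1 b \<noteq> 0" for b using pos(3)[of b] pos(4)[of b] by linarith
  have "y b + z b = x b" for b
  proof -
    have "q1 b / (q0 b + q1 b) + q0 b / (q0 b + q1 b) = 1" using ne[of b] by (simp flip: add_divide_distrib add: add.commute)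
    then show ?thesis unfolding y_def z_def
      by (metis distrib_right mult_1 of_real_1 of_real_add)
  qed
  then have x: "x = (\<lambda>b. y b + z b)" by simp
  have "(\<Sum>a\<in>UNIV. p0 a * p1 a / (p0 a + p1 a) * (cmod (T x a))\<^sup>2)
      \<le> (\<Sum>a\<in>UNIV. p0 a * (cmod (T y a))\<^sup>2 + p1 a * (cmod (T z a))\<^sup>2)"
    unfolding x add by (intro sum_mono parallel_sum_le pos)
  also have "\<dots> \<le> (\<Sum>b\<in>UNIV. q0 b * (cmod (y b))\<^sup>2 + q1 b * (cmod (z b))\<^sup>2)"
    unfolding sum.distrib by (intro add_mono bd0 bd1)
  also have "\<dots> = (\<Sum>b\<in>UNIV. q0 b * q1 b / (q0 b + q1 b) * (cmod (x b))\<^sup>2)"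
  proof (rule sum.cong)
    fix b
    have *: "u * (v / (u + v))\<^sup>2 + v * (u / (u + v))\<^sup>2 = u * v / (u + v)" if "u + v \<noteq> 0" for u v :: real
      using that by (simp add: power2_eq_square divide_simps) algebra
    have "q0 b * (cmod (y b))\<^sup>2 + q1 b * (cmod (z b))\<^sup>2
        = (q0 b * (q1 b / (q0 b + q1 b))\<^sup>2 + q1 b * (q0 b / (q0 b + q1 b))\<^sup>2) * (cmod (x b))\<^sup>2"
      unfolding y_def z_def norm_mult norm_of_real power_mult_distrib power2_abs
      by (simp only: distrib_right mult.assoc)
    then show "q0 b * (cmod (y b))\<^sup>2 + q1 b * (cmod (z b))\<^sup>2 = q0 b * q1 b / (q0 b + q1 b) * (cmod (x b))\<^sup>2"
      using *[OF ne] by simp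
  qed simp
  finally show ?thesis .
qed

text \<open>
  The integrand \<open>\<tau>\<^sup>-\<^sup>t / (1 + \<tau>)\<close> of Euler's integral for \<open>\<pi> / sin (\<pi> t)\<close>. It enters
  below as a common factor of both sides of an inequality, which can be cancelled because the integral
  is finite and positive.
\<close>

definition mean_kernel :: "real \<Rightarrow> real \<Rightarrow> real" where
  "mean_kernel t \<tau> = indicator {0<..} \<tau> * (\<tau> powr - t / (1 + \<tau>))"

lemma integrable_mean_kernel:
  assumes "0 < t" "t < 1"
  shows "integrable lborel (mean_kernel t)"
proof -
  define D where "D \<tau> = indicator {0..1} \<tau> *\<^sub>R (\<tau> powr - t) + indicator {1..} \<tau> *\<^sub>R (\<tau> powr (- t - 1))" for \<tau> :: real
  have "set_integrable lebesgue {0..1} (\<lambda>\<tau>::real. \<tau> powr - t)"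
    using assms by (intro nonnegative_absolutely_integrable_1 integrable_on_powr_from_0) auto
  then have 1: "integrable lborel (\<lambda>\<tau>::real. indicator {0..1} \<tau> *\<^sub>R \<tau> powr - t)"
    unfolding set_integrable_def by (subst (asm) integrable_completion) auto
  have "(\<lambda>\<tau>::real. \<tau> powr (- t - 1)) integrable_on {1..}"
    using has_integral_powr_to_inf[of "- t - 1" 1] assms by (auto simp: integrable_on_def)
  then have "set_integrable lebesgue {1..} (\<lambda>\<tau>::real. \<tau> powr (- t - 1))"
    by (intro nonnegative_absolutely_integrable_1) auto
  then have 2: "integrable lborel (\<lambda>\<tau>::real. indicator {1..} \<tau> *\<^sub>R \<tau> powr (- t - 1))"
    unfolding set_integrable_def by (subst (asm) integrable_completion) auto
  have "integrable lborel D"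
    unfolding D_def using 1 2 by (rule Bochner_Integration.integrable_add)
  then show ?thesis
  proof (rule Bochner_Integration.integrable_bound)
    show "mean_kernel t \<in> borel_measurable lborel"
      unfolding mean_kernel_def by measurable
    have "norm (mean_kernel t \<tau>) \<le> norm (D \<tau>)" for \<tau>
    proof (cases "0 < \<tau>")
      case True
      have "\<tau> powr - t / (1 + \<tau>) \<le> \<tau> powr - t" 
        using True by (simp add: divide_le_eq)
      moreover have "\<tau> powr - t / (1 + \<tau>) \<le> \<tau> powr (- t - 1)"
        using True by (simp add: powr_diff frac_le)
      moreover have "\<tau> \<le> 1 \<or> 1 \<le> \<tau>" by linarith
      ultimately have "mean_kernel t \<tau> \<le> D \<tau>"
        using True by (auto simp: mean_kernel_def D_def indicator_def intro: add_increasing add_increasing2)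
      moreover have "0 \<le> mean_kernel t \<tau>"
        using True by (simp add: mean_kernel_def)
      ultimately show ?thesis by simp
    qed (simp add: mean_kernel_def)
    then show "AE \<tau> in lborel. norm (mean_kernel t \<tau>) \<le> norm (D \<tau>)" by simp
  qed
qed

lemma integral_mean_kernel_pos:
  assumes "0 < t" "t < 1"
  shows "0 < (LINT \<tau>|lborel. mean_kernel t \<tau>)"
proof -
  have "0 < (LINT \<tau>|lborel. indicator {0<..1::real} \<tau> * (1/2 :: real))" by simp
  also have "\<dots> \<le> (LINT \<tau>|lborel. mean_kernel t \<tau>)"
  proof (intro integral_mono integrable_mean_kernel assms)
    fix \<tau> :: real
    show "indicator {0<..1::real} \<tau> * (1/2 :: real) \<le> mean_kernel t \<tau>"
    proof (cases "0 < \<tau> \<and> \<tau> \<le> 1")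
      case True
      then have "1 \<le> \<tau> powr - t"
        using assms powr_mono2'[of "- t" \<tau> 1] by simp
      with True have "1 / 2 \<le> \<tau> powr - t / (1 + \<tau>)"
        by (intro frac_le) auto
      then show ?thesis using True by (simp add: mean_kernel_def)
    qed (auto simp: mean_kernel_def)
  qed simp
  finally show ?thesis .
qed

text \<open>
  Substituting \<open>\<tau> p1 / p0\<close> for the variable turns the kernel into a multiple of the parallel sum
  of \<open>p0\<close> and \<open>\<tau> p1\<close>; the scaling produces the geometric mean. Thus weighted geometric means are
  superpositions of parallel sums.
\<close>

lemma parallel_sum_integral:
  assumes t: "0 < t" "t < 1" and pos: "0 < p0" "0 < p1"
  shows "has_bochner_integral lborel
      (\<lambda>\<tau>. indicator {0<..} \<tau> * \<tau> powr (- 1 - t) * (p0 * (\<tau> * p1) / (p0 + \<tau> * p1)))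
      (p0 powr (1 - t) * p1 powr t * (LINT \<tau>|lborel. mean_kernel t \<tau>))"
proof -
  define c where "c = p1 / p0"
  have c: "0 < c" using pos by (simp add: c_def)
  have "has_bochner_integral lborel (mean_kernel t) (LINT \<tau>|lborel. mean_kernel t \<tau>)"
    using integrable_mean_kernel[OF t] by (rule has_bochner_integral_integrable)
  then have "has_bochner_integral lborel (\<lambda>\<tau>. mean_kernel t (0 + c * \<tau>)) ((LINT \<tau>|lborel. mean_kernel t \<tau>) /\<^sub>R \<bar>c\<bar>)"
    using c by (subst (asm) lborel_has_bochner_integral_real_affine_iff[of c _ _ 0]) auto
  then have "has_bochner_integral lborel (\<lambda>\<tau>. p1 * c powr t * mean_kernel t (0 + c * \<tau>))
     (p1 * c powr t * ((LINT \<tau>|lborel. mean_kernel t \<tau>) /\<^sub>R \<bar>c\<bar>))"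
    by (intro has_bochner_integral_mult_right) auto
  moreover have "p1 * c powr t * mean_kernel t (0 + c * \<tau>)
     = indicator {0<..} \<tau> * \<tau> powr (- 1 - t) * (p0 * (\<tau> * p1) / (p0 + \<tau> * p1))" for \<tau>
  proof (cases "0 < \<tau>")
    case True
    then have "c powr t * (c * \<tau>) powr - t = \<tau> powr - t"
      using c by (simp add: powr_mult powr_minus)
    moreover have "\<tau> powr - t = \<tau> powr (- 1 - t) * \<tau>"
      using True powr_add[of \<tau> "- 1 - t" 1] by simp
    moreover have "1 / (1 + c * \<tau>) = p0 / (p0 + \<tau> * p1)"
      using pos True by (simp add: c_def field_simps)
    moreover have "mean_kernel t (0 + c * \<tau>) = (c * \<tau>) powr - t * (1 / (1 + c * \<tau>))"
      using True c by (simp add: mean_kernel_def)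
    ultimately have "p1 * c powr t * mean_kernel t (0 + c * \<tau>) = p1 * (\<tau> powr (- 1 - t) * \<tau>) * (p0 / (p0 + \<tau> * p1))"
      by (metis mult.assoc)
    then show ?thesis
      using True by (simp add: mult_ac)
  next
    case False
    then show ?thesis using c by (simp add: mean_kernel_def zero_less_mult_iff)
  qed
  moreover have "p1 * c powr t * ((LINT \<tau>|lborel. mean_kernel t \<tau>) /\<^sub>R \<bar>c\<bar>)
      = p0 powr (1 - t) * p1 powr t * (LINT \<tau>|lborel. mean_kernel t \<tau>)"
    using pos c by (simp add: c_def powr_divide powr_diff field_simps)
  ultimately show ?thesis by (simp only:)
qed

text \<open>
  For \<open>0 < t < 1\<close>, apply the parallel sum bound to \<open>p0\<close>, \<open>\<tau> p1\<close> and \<open>q0\<close>, \<open>\<tau> q1\<close> for each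
  \<open>\<tau> > 0\<close> and integrate against \<open>\<tau> powr (- 1 - t)\<close>. This is the \<open>L\<^sup>2\<close> case of the interpolation
  theorem with change of weights, with constant one.
\<close>

lemma weighted_interpolation:
  fixes T :: "('b::finite \<Rightarrow> complex) \<Rightarrow> ('a::finite \<Rightarrow> complex)"
  assumes add: "\<And>x y a. T (\<lambda>b. x b + y b) a = T x a + T y a"
    and pos: "\<And>a. 0 < p0 a" "\<And>a. 0 < p1 a" "\<And>b. 0 < q0 b" "\<And>b. 0 < q1 b"
    and bd0: "\<And>x. (\<Sum>a\<in>UNIV. p0 a * (cmod (T x a))\<^sup>2) \<le> (\<Sum>b\<in>UNIV. q0 b * (cmod (x b))\<^sup>2)"
    and bd1: "\<And>x. (\<Sum>a\<in>UNIV. p1 a * (cmod (T x a))\<^sup>2) \<le> (\<Sum>b\<in>UNIV. q1 b * (cmod (x b))\<^sup>2)"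
    and t: "0 \<le> t" "t \<le> 1"
  shows "(\<Sum>a\<in>UNIV. p0 a powr (1 - t) * p1 a powr t * (cmod (T x a))\<^sup>2)
       \<le> (\<Sum>b\<in>UNIV. q0 b powr (1 - t) * q1 b powr t * (cmod (x b))\<^sup>2)"
proof -
  consider "t = 0" | "t = 1" | "0 < t" "t < 1" using t by linarith
  then show ?thesis
  proof cases
    case 1
    then show ?thesis using bd0 pos by (simp add: less_imp_neq[THEN not_sym] less_imp_le)
  next
    case 2
    then show ?thesis using bd1 pos by (simp add: less_imp_neq[THEN not_sym] less_imp_le)
  next
    case 3
    define C where "C = (LINT \<tau>|lborel. mean_kernel t \<tau>)"
    define k where "k p r \<tau> = indicator {0<..} \<tau> * \<tau> powr (- 1 - t) * (p * (\<tau> * r) / (p + \<tau> * r))" for p r \<tau> :: real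
    have int: "has_bochner_integral lborel (\<lambda>\<tau>. \<Sum>a\<in>UNIV. k (p a) (r a) \<tau> * u a)
        (\<Sum>a\<in>UNIV. p a powr (1 - t) * r a powr t * C * u a)"
      if "\<And>a. 0 < p a" "\<And>a. 0 < r a" for p r u :: "'c::finite \<Rightarrow> real"
      unfolding k_def C_def using that 3
      by (intro has_bochner_integral_sum has_bochner_integral_mult_left parallel_sum_integral) auto
    have le: "(\<Sum>a\<in>UNIV. k (p0 a) (p1 a) \<tau> * (cmod (T x a))\<^sup>2)
        \<le> (\<Sum>b\<in>UNIV. k (q0 b) (q1 b) \<tau> * (cmod (x b))\<^sup>2)" for \<tau>
    proof (cases "0 < \<tau>")
      case True
      have "(\<Sum>a\<in>UNIV. p0 a * (\<tau> * p1 a) / (p0 a + \<tau> * p1 a) * (cmod (T x a))\<^sup>2)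
          \<le> (\<Sum>b\<in>UNIV. q0 b * (\<tau> * q1 b) / (q0 b + \<tau> * q1 b) * (cmod (x b))\<^sup>2)"
      proof (rule parallel_sum_weights[OF add pos(1) _ pos(3) _ bd0])
        show "(\<Sum>a\<in>UNIV. \<tau> * p1 a * (cmod (T x a))\<^sup>2) \<le> (\<Sum>b\<in>UNIV. \<tau> * q1 b * (cmod (x b))\<^sup>2)" for x
          using mult_left_mono[OF bd1[of x], of \<tau>] True by (simp add: sum_distrib_left mult.assoc)
      qed (use True pos in auto)
      then have "\<tau> powr (- 1 - t) * (\<Sum>a\<in>UNIV. p0 a * (\<tau> * p1 a) / (p0 a + \<tau> * p1 a) * (cmod (T x a))\<^sup>2)
          \<le> \<tau> powr (- 1 - t) * (\<Sum>b\<in>UNIV. q0 b * (\<tau> * q1 b) / (q0 b + \<tau> * q1 b) * (cmod (x b))\<^sup>2)"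
        by (rule mult_left_mono) simp
      then show ?thesis using True
        by (simp add: k_def sum_distrib_left mult.assoc)
    qed (simp add: k_def)
    have I0: "has_bochner_integral lborel (\<lambda>\<tau>. \<Sum>a\<in>UNIV. k (p0 a) (p1 a) \<tau> * (cmod (T x a))\<^sup>2)
        (\<Sum>a\<in>UNIV. p0 a powr (1 - t) * p1 a powr t * C * (cmod (T x a))\<^sup>2)"
      by (rule int) (rule pos)+
    have I1: "has_bochner_integral lborel (\<lambda>\<tau>. \<Sum>b\<in>UNIV. k (q0 b) (q1 b) \<tau> * (cmod (x b))\<^sup>2)
        (\<Sum>b\<in>UNIV. q0 b powr (1 - t) * q1 b powr t * C * (cmod (x b))\<^sup>2)"
      by (rule int) (rule pos)+
    have "(\<Sum>a\<in>UNIV. p0 a powr (1 - t) * p1 a powr t * C * (cmod (T x a))\<^sup>2)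
        \<le> (\<Sum>b\<in>UNIV. q0 b powr (1 - t) * q1 b powr t * C * (cmod (x b))\<^sup>2)"
    proof -
      have "integrable lborel (\<lambda>\<tau>. \<Sum>a\<in>UNIV. k (p0 a) (p1 a) \<tau> * (cmod (T x a))\<^sup>2)"
        "integrable lborel (\<lambda>\<tau>. \<Sum>b\<in>UNIV. k (q0 b) (q1 b) \<tau> * (cmod (x b))\<^sup>2)"
        using I0 I1 unfolding has_bochner_integral_iff by blast+
      then have "(LINT \<tau>|lborel. (\<Sum>a\<in>UNIV. k (p0 a) (p1 a) \<tau> * (cmod (T x a))\<^sup>2))
          \<le> (LINT \<tau>|lborel. (\<Sum>b\<in>UNIV. k (q0 b) (q1 b) \<tau> * (cmod (x b))\<^sup>2))"
        by (rule integral_mono) (rule le)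
      then show ?thesis
        unfolding has_bochner_integral_integral_eq[OF I0] has_bochner_integral_integral_eq[OF I1] .
    qed
    then have "C * (\<Sum>a\<in>UNIV. p0 a powr (1 - t) * p1 a powr t * (cmod (T x a))\<^sup>2)
        \<le> C * (\<Sum>b\<in>UNIV. q0 b powr (1 - t) * q1 b powr t * (cmod (x b))\<^sup>2)"
      by (simp add: sum_distrib_left mult_ac)
    moreover have "0 < C" unfolding C_def by (rule integral_mean_kernel_pos[OF 3])
    ultimately show ?thesis by simp
  qed
qed

section \<open>Traces in eigenbases\<close>

lemma real_diag_mult: "real_diag d ** real_diag e = real_diag (\<lambda>i. d i * e i)"
  unfolding vec_eq_iff real_diag_mult_left by (simp add: real_diag_def)

lemma unitary_conjugate_mult:
  assumes "unitary W"
  shows "(W ** X ** ctranspose W) ** (W ** Y ** ctranspose W) = W ** (X ** Y) ** ctranspose W"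
proof -
  have "(W ** X ** ctranspose W) ** (W ** Y ** ctranspose W)
      = W ** X ** (ctranspose W ** W) ** Y ** ctranspose W"
    by (simp only: matrix_mul_assoc)
  moreover have "W ** X ** (ctranspose W ** W) ** Y = W ** (X ** Y)"
    using assms by (simp add: unitary_def) (simp add: matrix_mul_assoc)
  ultimately show ?thesis by simp
qed

lemma unitary_conjugate_1: "unitary W \<Longrightarrow> W ** real_diag (\<lambda>_. 1) ** ctranspose W = mat 1"
  by (simp add: real_diag_1 unitary_def)

lemma cscale_mult_left: "cscale c P ** Q = cscale c (P ** Q)"
  by (simp add: vec_eq_iff cscale_def matrix_matrix_mult_def sum_distrib_left mult_ac)

lemma cscale_mat_1_spectral:
  assumes "unitary W"
  shows "cscale (complex_of_real c) (mat 1) = W ** real_diag (\<lambda>_. c) ** ctranspose W"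
proof -
  have "W ** real_diag (\<lambda>_. c) = cscale (complex_of_real c) W"
    by (simp add: vec_eq_iff real_diag_mult_right cscale_def mult.commute)
  then have "W ** real_diag (\<lambda>_. c) ** ctranspose W = cscale (complex_of_real c) (W ** ctranspose W)"
    by (simp add: cscale_mult_left)
  then show ?thesis using assms by (simp add: unitary_def)
qed

lemma trace_spectral:
  "trace (P ** (V ** real_diag z ** ctranspose V))
    = (\<Sum>j\<in>UNIV. of_real (z j) * cinner (column j V) (P *v column j V))"
proof -
  have "trace (P ** (V ** real_diag z ** ctranspose V)) = trace ((P ** V ** real_diag z) ** ctranspose V)"
    by (simp add: matrix_mul_assoc)
  also have "\<dots> = trace ((ctranspose V ** P ** V) ** real_diag z)"
    by (subst trace_mul_sym) (simp add: matrix_mul_assoc)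
  finally show ?thesis
    by (simp add: trace_def real_diag_mult_right conjugate_nth mult.commute)
qed

lemma trace_unitary_conjugate:
  assumes "unitary W"
  shows "trace (W ** real_diag d ** ctranspose W) = complex_of_real (\<Sum>i\<in>UNIV. d i)"
  using trace_spectral[of "mat 1" W d] assms gram_nth[of W W, symmetric]
  by (simp add: unitary_def) (simp add: mat_def)

text \<open>
  The operator \<open>B \<mapsto> A B Z\<close> is diagonal in the matrix units built from eigenbases of \<open>A\<close> and \<open>Z\<close>.
  The sum runs over pairs of indices so that it is directly a weighted square norm on functions on a
  finite type.
\<close>

lemma trace_weighted:
  fixes B :: "'n::finite cmat"
  shows "trace (ctranspose B ** (U ** real_diag a ** ctranspose U) ** B ** (V ** real_diag z ** ctranspose V))
     = complex_of_real (\<Sum>e\<in>UNIV. a (fst e) * z (snd e) * (cmod ((ctranspose U ** B ** V) $ fst e $ snd e))\<^sup>2)"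
proof -
  define C where "C = ctranspose U ** B ** V"
  define P where "P = ctranspose B ** (U ** real_diag a ** ctranspose U) ** B"
  have "ctranspose V ** P ** V = ctranspose C ** (real_diag a ** C)"
    by (simp add: P_def C_def ctranspose_mult matrix_mul_assoc)
  then have "(ctranspose V ** P ** V) $ j $ j = (\<Sum>i\<in>UNIV. of_real (a i) * (C $ i $ j * cnj (C $ i $ j)))" for j
    unfolding matrix_matrix_mult_def[of "ctranspose C"]
    by (simp add: real_diag_mult_left mult_ac)
  then have "trace (P ** (V ** real_diag z ** ctranspose V))
      = (\<Sum>j\<in>UNIV. \<Sum>i\<in>UNIV. complex_of_real (a i * z j * (cmod (C $ i $ j))\<^sup>2))"
    unfolding trace_spectral conjugate_nth[symmetric] of_real_mult complex_norm_square
    by (simp add: sum_distrib_left mult_ac)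
  also have "\<dots> = (\<Sum>i\<in>UNIV. \<Sum>j\<in>UNIV. complex_of_real (a i * z j * (cmod (C $ i $ j))\<^sup>2))"
    by (rule sum.swap)
  also have "\<dots> = complex_of_real (\<Sum>e\<in>UNIV. a (fst e) * z (snd e) * (cmod (C $ fst e $ snd e))\<^sup>2)"
    unfolding of_real_sum sum.cartesian_product UNIV_Times_UNIV
    by (rule sum.cong) auto
  finally show ?thesis by (simp add: P_def C_def)
qed

lemma hs_inner_pairs: "hs_inner X Y = (\<Sum>e\<in>UNIV. cnj (X $ fst e $ snd e) * Y $ fst e $ snd e)"
  unfolding hs_inner_sum sum.cartesian_product UNIV_Times_UNIV by (rule sum.cong) auto

lemma hs_inner_unitary:
  assumes "unitary U" "unitary V"
  shows "hs_inner (ctranspose U ** X ** V) (ctranspose U ** Y ** V) = hs_inner X Y"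
proof -
  have "ctranspose (ctranspose U ** X ** V) ** (ctranspose U ** Y ** V)
      = ctranspose V ** (ctranspose X ** (U ** ctranspose U) ** Y ** V)"
    by (simp add: ctranspose_mult matrix_mul_assoc)
  also have "\<dots> = ctranspose V ** (ctranspose X ** Y ** V)"
    using assms by (simp add: unitary_def)
  finally have "hs_inner (ctranspose U ** X ** V) (ctranspose U ** Y ** V)
      = trace (ctranspose V ** (ctranspose X ** Y ** V))"
    by (simp add: hs_inner_def)
  also have "\<dots> = trace ((ctranspose X ** Y ** V) ** ctranspose V)"
    by (rule trace_mul_sym)
  also have "\<dots> = trace (ctranspose X ** Y ** (V ** ctranspose V))"
    by (simp add: matrix_mul_assoc)
  finally show ?thesis using assms by (simp add: hs_inner_def unitary_def)
qed

section \<open>Schwarz maps\<close>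

lemma pos_semidef_add: "pos_semidef X \<Longrightarrow> pos_semidef Y \<Longrightarrow> pos_semidef (X + Y)"
  by (simp add: pos_semidef_def matrix_vector_mult_add_rdistrib cinner_add_right)

lemma schwarz_map_gram_pos_semidef:
  assumes "schwarz_map \<Phi>"
  shows "pos_semidef (\<Phi> (ctranspose X ** X))"
proof -
  have "pos_semidef (\<Phi> (ctranspose X ** X) - ctranspose (\<Phi> X) ** \<Phi> X)"
    using assms by (auto simp: schwarz_map_def loewner_le_def)
  from pos_semidef_add[OF this pos_semidef_gram[of "\<Phi> X"]] show ?thesis by simp
qed

lemma schwarz_map_add: "schwarz_map \<Phi> \<Longrightarrow> \<Phi> (X + Y) = \<Phi> X + \<Phi> Y"
  unfolding schwarz_map_def Vector_Spaces.linear_iff by blast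

lemma schwarz_map_cscale: "schwarz_map \<Phi> \<Longrightarrow> \<Phi> (cscale c X) = cscale c (\<Phi> X)"
  unfolding schwarz_map_def Vector_Spaces.linear_iff by blast

lemma matrix_mult_add_left: "(P + Q) ** R = P ** R + Q ** (R :: 'n::finite cmat)"
  by (simp add: vec_eq_iff matrix_matrix_mult_def distrib_right sum.distrib)

lemma matrix_mult_diff_left: "(P - Q) ** R = P ** R - Q ** (R :: 'n::finite cmat)"
  by (simp add: vec_eq_iff matrix_matrix_mult_def left_diff_distrib sum_subtractf)

text \<open>
  A Schwarz map sends Gram matrices to positive, hence Hermitian, matrices. Comparing the images of
  the Gram matrices of \<open>1\<close>, \<open>X\<close> and \<open>1 + c X\<close> shows that \<open>c \<Phi>(X) + cnj c \<Phi>(X\<^sup>*)\<close> is Hermitian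
  for \<open>|c| = 1\<close>; the choices \<open>c = 1\<close> and \<open>c = \<i>\<close> give the claim.
\<close>

lemma schwarz_map_ctranspose:
  assumes \<Phi>: "schwarz_map \<Phi>"
  shows "\<Phi> (ctranspose X) = ctranspose (\<Phi> X)"
proof -
  have gram: "cnj (\<Phi> (ctranspose Y ** Y) $ j $ i) = \<Phi> (ctranspose Y ** Y) $ i $ j" for Y i j
    using pos_semidef_hermitian[OF schwarz_map_gram_pos_semidef[OF \<Phi>, of Y]]
    by (metis ctranspose_nth)
  have ct_add: "ctranspose (P + Q) = ctranspose P + ctranspose Q" for P Q :: "'c::finite cmat"
    by (simp add: vec_eq_iff)
  have ct_scale: "ctranspose (cscale c P) = cscale (cnj c) (ctranspose P)" for c and P :: "'c::finite cmat"
    by (simp add: vec_eq_iff cscale_def)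
  have mult_scale: "cscale c P ** Q = cscale c (P ** Q)" "P ** cscale c Q = cscale c (P ** Q)"
    for c and P Q :: "'c::finite cmat"
    by (simp_all add: vec_eq_iff cscale_def matrix_matrix_mult_def sum_distrib_left mult_ac)
  have cscale_cscale: "cscale c (cscale d P) = cscale (c * d) P" for c d and P :: "'c::finite cmat"
    by (simp add: vec_eq_iff cscale_def)
  have cscale_add: "cscale c (P + Q) = cscale c P + cscale c Q" for c and P Q :: "'c::finite cmat"
    by (simp add: vec_eq_iff cscale_def distrib_left)
  have cscale_1: "cscale 1 P = P" for P :: "'c::finite cmat"
    by (simp add: vec_eq_iff cscale_def)
  have expand: "ctranspose (mat 1 + cscale c X) ** (mat 1 + cscale c X)
      = ctranspose (mat 1) ** mat 1 + cscale c X + cscale (cnj c) (ctranspose X) + cscale (cnj c * c) (ctranspose X ** X)" for c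
    by (simp add: ct_add ct_scale matrix_add_ldistrib matrix_mult_add_left mult_scale cscale_cscale cscale_add mult.commute)
  have polar: "cnj (c * \<Phi> X $ j $ i + cnj c * \<Phi> (ctranspose X) $ j $ i) = c * \<Phi> X $ i $ j + cnj c * \<Phi> (ctranspose X) $ i $ j"
    if c: "cnj c * c = 1" for c i j
    using gram[of "mat 1 + cscale c X" j i] gram[of "mat 1" j i] gram[of X j i]
    unfolding expand schwarz_map_add[OF \<Phi>] schwarz_map_cscale[OF \<Phi>] c cscale_1
    by (simp add: cscale_def)
  have "\<Phi> (ctranspose X) $ i $ j = cnj (\<Phi> X $ j $ i)" for i j
    using polar[of 1 j i] polar[of \<i> j i] by (simp add: complex_eq_iff)
  then show ?thesis by (simp add: vec_eq_iff)
qed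

section \<open>The adjoint of a Schwarz map\<close>

text \<open>
  The projection onto the line of \<open>x\<close> (up to scale), written as a Gram matrix so that the Schwarz
  property applies to it. The conjugate comes from the inner product being antilinear on the left.
\<close>

lemma rank_one_gram:
  obtains W :: "'m::finite cmat" where "\<And>Y. hs_inner Y (ctranspose W ** W) = cnj (cinner x (Y *v x))"
proof -
  obtain k :: 'm where True by simp
  define W :: "'m cmat" where "W = (\<chi> i j. if i = k then cnj (x $ j) else 0)"
  have "(ctranspose W ** W) $ i $ j = x $ i * cnj (x $ j)" for i j
    by (simp add: matrix_matrix_mult_def W_def if_distrib if_distribR cong: if_cong)
  then have "hs_inner Y (ctranspose W ** W) = cnj (cinner x (Y *v x))" for Y
    by (simp add: hs_inner_sum cinner_def matrix_vector_mult_def sum_distrib_left mult_ac)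
  then show ?thesis by (rule that)
qed

lemma trace_mult_nonneg:
  assumes "pos_semidef P" "pos_semidef Q"
  shows "0 \<le> trace (P ** Q)"
proof -
  obtain V z where "\<And>i. 0 \<le> z i" and "Q = V ** real_diag z ** ctranspose V"
    using pos_semidef_spectral[OF assms(2)] by metis
  then show ?thesis
    using assms(1)
    by (auto simp: trace_spectral pos_semidef_def less_eq_complex_def intro!: sum_nonneg mult_nonneg_nonneg)
qed

lemma hs_inner_hermitian: "ctranspose Z = Z \<Longrightarrow> hs_inner Z P = trace (P ** Z)"
  by (simp add: hs_inner_def) (rule trace_mul_sym)

lemma schwarz_map_hs_adjoint: "schwarz_map \<Phi> \<Longrightarrow> hs_inner (hs_adjoint \<Phi> Y) X = hs_inner Y (\<Phi> X)"
  by (rule hs_adjoint) (simp add: schwarz_map_def)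

lemma hs_adjoint_pos_semidef:
  fixes \<Phi> :: "'m::finite cmat \<Rightarrow> 'n::finite cmat"
  assumes \<Phi>: "schwarz_map \<Phi>" and Z: "pos_semidef Z"
  shows "pos_semidef (hs_adjoint \<Phi> Z)"
  unfolding pos_semidef_def
proof
  fix x
  obtain W :: "'m cmat" where W: "\<And>Y. hs_inner Y (ctranspose W ** W) = cnj (cinner x (Y *v x))"
    using rank_one_gram by blast
  have "0 \<le> hs_inner (hs_adjoint \<Phi> Z) (ctranspose W ** W)"
    unfolding schwarz_map_hs_adjoint[OF \<Phi>] hs_inner_hermitian[OF pos_semidef_hermitian[OF Z]]
    by (intro trace_mult_nonneg schwarz_map_gram_pos_semidef \<Phi> Z)
  then show "0 \<le> cinner x (hs_adjoint \<Phi> Z *v x)"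
    by (simp add: W less_eq_complex_def)
qed

text \<open>
  Let \<open>P\<close> be the image of the rank one matrix of \<open>x\<close>. In an eigenbasis of \<open>A\<close>, vanishing of the
  quadratic form of \<open>\<Psi>(A)\<close> at \<open>x\<close> forces the diagonal of \<open>P\<close> to vanish, hence also \<open>Tr P\<close>. But
  \<open>Tr P\<close> is the quadratic form of \<open>\<Psi>(1) = \<kappa> 1\<close> at \<open>x\<close>.
\<close>

lemma hs_adjoint_pos_def:
  fixes \<Phi> :: "'m::finite cmat \<Rightarrow> 'n::finite cmat"
  assumes \<Phi>: "schwarz_map \<Phi>" and one: "hs_adjoint \<Phi> (mat 1) = cscale (complex_of_real \<kappa>) (mat 1)"
    and \<kappa>: "0 < \<kappa>" and A: "pos_def A"
  shows "pos_def (hs_adjoint \<Phi> A)"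
  unfolding pos_def_def
proof (intro allI impI)
  fix x :: "complex ^ 'm" assume "x \<noteq> 0"
  obtain W where W: "\<And>Y. hs_inner Y (ctranspose W ** W) = cnj (cinner x (Y *v x))"
    using rank_one_gram by blast
  define P where "P = \<Phi> (ctranspose W ** W)"
  obtain U a where U: "unitary U" and a: "\<And>i. 0 < a i" and A_eq: "A = U ** real_diag a ** ctranspose U"
    using pos_def_spectral[OF A] by metis
  define p where "p j = Re (cinner (column j U) (P *v column j U))" for j
  have "0 \<le> cinner (column j U) (P *v column j U)" for j
    using schwarz_map_gram_pos_semidef[OF \<Phi>, of W] by (simp add: P_def pos_semidef_def)
  then have p: "0 \<le> p j" "cinner (column j U) (P *v column j U) = p j" for j
    by (simp_all add: p_def less_eq_complex_def complex_eq_iff)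
  have inner: "hs_inner (U ** real_diag d ** ctranspose U) P = of_real (\<Sum>j\<in>UNIV. d j * p j)" for d
  proof -
    have "ctranspose (U ** real_diag d ** ctranspose U) = U ** real_diag d ** ctranspose U"
      by (simp add: ctranspose_mult matrix_mul_assoc)
    then show ?thesis by (simp add: hs_inner_hermitian trace_spectral p)
  qed
  have psd: "0 \<le> cinner x (hs_adjoint \<Phi> A *v x)"
    using hs_adjoint_pos_semidef[OF \<Phi> pos_def_imp_pos_semidef[OF A]] by (simp add: pos_semidef_def)
  have "cinner x (hs_adjoint \<Phi> A *v x) \<noteq> 0"
  proof
    assume "cinner x (hs_adjoint \<Phi> A *v x) = 0"
    then have "hs_inner A P = 0"
      using W[of "hs_adjoint \<Phi> A"] by (simp add: schwarz_map_hs_adjoint[OF \<Phi>] P_def)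
    then have "(\<Sum>j\<in>UNIV. a j * p j) = 0"
      unfolding A_eq inner by (simp only: of_real_eq_0_iff)
    then have "\<forall>j\<in>UNIV. a j * p j = 0"
      using a p(1) by (subst (asm) sum_nonneg_eq_0_iff) (auto simp: less_imp_le)
    then have "p j = 0" for j by (metis UNIV_I a less_irrefl mult_eq_0_iff)
    then have "hs_inner (mat 1) P = 0"
      using inner[of "\<lambda>_. 1"] by (simp add: unitary_conjugate_1[OF U])
    then have "cinner x (cscale (complex_of_real \<kappa>) (mat 1) *v x) = 0"
      using W[of "hs_adjoint \<Phi> (mat 1)"] unfolding schwarz_map_hs_adjoint[OF \<Phi>] P_def[symmetric]
      by (simp add: one)
    moreover have "cscale (complex_of_real \<kappa>) (mat 1) *v x = complex_of_real \<kappa> *s x"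
      by (simp add: vec_eq_iff cscale_def mat_def matrix_vector_mult_def if_distrib if_distribR cong: if_cong)
    ultimately have "cinner x x = 0"
      using \<kappa> by (simp add: cinner_scale_right)
    then show False using cinner_self_pos[OF \<open>x \<noteq> 0\<close>] by simp
  qed
  then show "0 < cinner x (hs_adjoint \<Phi> A *v x)" using psd by simp
qed

text \<open>
  Pair the Schwarz inequality for \<open>Y\<close> with \<open>Z\<close> and move \<open>\<Phi>\<close> to the other side. This is the
  exponent pair \<open>(0,1)\<close>, and \<open>(0,0)\<close> for \<open>Z = 1\<close>; the next lemma, obtained by exchanging \<open>Y\<close> and
  \<open>Y\<^sup>*\<close>, is the pair \<open>(1,0)\<close>.
\<close>

lemma schwarz_map_trace_right:
  assumes \<Phi>: "schwarz_map \<Phi>" and Z: "pos_semidef Z"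
  shows "trace (ctranspose (\<Phi> Y) ** \<Phi> Y ** Z) \<le> trace (ctranspose Y ** Y ** hs_adjoint \<Phi> Z)"
proof -
  have "0 \<le> trace ((\<Phi> (ctranspose Y ** Y) - ctranspose (\<Phi> Y) ** \<Phi> Y) ** Z)"
    using \<Phi> by (intro trace_mult_nonneg Z) (auto simp: schwarz_map_def loewner_le_def)
  then have "trace (ctranspose (\<Phi> Y) ** \<Phi> Y ** Z) \<le> trace (\<Phi> (ctranspose Y ** Y) ** Z)"
    by (simp add: matrix_mult_diff_left trace_sub)
  also have "\<dots> = hs_inner (hs_adjoint \<Phi> Z) (ctranspose Y ** Y)"
    by (simp add: schwarz_map_hs_adjoint[OF \<Phi>] hs_inner_hermitian pos_semidef_hermitian[OF Z])
  also have "\<dots> = trace (ctranspose Y ** Y ** hs_adjoint \<Phi> Z)"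
    by (intro hs_inner_hermitian pos_semidef_hermitian hs_adjoint_pos_semidef \<Phi> Z)
  finally show ?thesis .
qed

lemma schwarz_map_trace_left:
  assumes \<Phi>: "schwarz_map \<Phi>" and A: "pos_semidef A"
  shows "trace (ctranspose (\<Phi> Y) ** A ** \<Phi> Y) \<le> trace (ctranspose Y ** hs_adjoint \<Phi> A ** Y)"
proof -
  have swap: "trace (F ** ctranspose F ** C) = trace (ctranspose F ** C ** F)" for F C :: "'c::finite cmat"
    using trace_mul_sym[of F "ctranspose F ** C"] by (simp add: matrix_mul_assoc)
  show ?thesis
    using schwarz_map_trace_right[OF assms, of "ctranspose Y"]
    by (simp add: schwarz_map_ctranspose[OF \<Phi>] swap)
qed

section \<open>Monotonicity of the trace functional\<close>

lemma pair_sum_trace: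
  assumes "unitary U" "unitary V"
  shows "trace (ctranspose F ** F ** (V ** real_diag z ** ctranspose V))
      = complex_of_real (\<Sum>e\<in>UNIV. z (snd e) * (cmod ((ctranspose U ** F ** V) $ fst e $ snd e))\<^sup>2)"
    and "trace (ctranspose F ** (U ** real_diag a ** ctranspose U) ** F)
      = complex_of_real (\<Sum>e\<in>UNIV. a (fst e) * (cmod ((ctranspose U ** F ** V) $ fst e $ snd e))\<^sup>2)"
  using trace_weighted[of F U "\<lambda>_. 1" V z] trace_weighted[of F U a V "\<lambda>_. 1"]
  by (simp_all add: unitary_conjugate_1 assms)

text \<open>
  In the coordinates given by the four eigenbases, \<open>\<Phi>\<close> is an additive map \<open>T\<close> between functions on
  pairs of indices. The exponents are interpolated first along the edge from \<open>(1,0)\<close> to \<open>(0,1)\<close>, and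
  then between the point reached there and \<open>(0,0)\<close>.
\<close>

lemma schwarz_map_weighted_interpolation:
  fixes \<Phi> :: "'m::finite cmat \<Rightarrow> 'n::finite cmat"
  assumes \<Phi>: "schwarz_map \<Phi>" and one: "hs_adjoint \<Phi> (mat 1) = cscale (complex_of_real \<kappa>) (mat 1)"
    and \<kappa>: "0 < \<kappa>" and sr: "0 \<le> s" "0 \<le> r" "s + r \<le> 1"
    and unit: "unitary U" "unitary V" "unitary E" "unitary G"
    and pos: "\<And>i. 0 < a i" "\<And>i. 0 < z i" "\<And>k. 0 < \<alpha> k" "\<And>k. 0 < \<zeta> k"
    and A: "hs_adjoint \<Phi> (U ** real_diag a ** ctranspose U) = E ** real_diag \<alpha> ** ctranspose E"
    and Z: "hs_adjoint \<Phi> (V ** real_diag z ** ctranspose V) = G ** real_diag \<zeta> ** ctranspose G"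
  shows "(\<Sum>e\<in>UNIV. a (fst e) powr s * z (snd e) powr r * (cmod ((ctranspose U ** \<Phi> (E ** C ** ctranspose G) ** V) $ fst e $ snd e))\<^sup>2)
    \<le> \<kappa> powr (1 - s - r) * (\<Sum>e\<in>UNIV. \<alpha> (fst e) powr s * \<zeta> (snd e) powr r * (cmod (C $ fst e $ snd e))\<^sup>2)"
proof -
  define Y where "Y x = E ** (\<chi> k l. x (k, l)) ** ctranspose G" for x :: "'m \<times> 'm \<Rightarrow> complex"
  define T where "T x e = (ctranspose U ** \<Phi> (Y x) ** V) $ fst e $ snd e" for x e
  have Y_add: "Y (\<lambda>b. x b + y b) = Y x + Y y" for x y
  proof -
    have "(\<chi> k l. x (k, l) + y (k, l)) = (\<chi> k l. x (k, l)) + (\<chi> k l. y (k, l))"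
      by (simp add: vec_eq_iff)
    then show ?thesis by (simp add: Y_def matrix_add_ldistrib matrix_mult_add_left)
  qed
  have T_add: "T (\<lambda>b. x b + y b) e = T x e + T y e" for x y e
    by (simp add: T_def Y_add schwarz_map_add[OF \<Phi>] matrix_add_ldistrib matrix_mult_add_left)
  have coord: "(ctranspose E ** Y x ** G) $ fst e $ snd e = x e" for x e
  proof -
    have "ctranspose E ** Y x ** G = (ctranspose E ** E) ** (\<chi> k l. x (k, l)) ** (ctranspose G ** G)"
      by (simp only: Y_def matrix_mul_assoc)
    then show ?thesis using unit by (simp add: unitary_def)
  qed
  have psd: "pos_semidef (W ** real_diag d ** ctranspose W)" if "unitary W" "\<And>i. 0 < d i" for W :: "'n cmat" and d
    using that by (intro pos_def_imp_pos_semidef pos_def_of_spectral)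
  have right: "(\<Sum>e\<in>UNIV. w (snd e) * (cmod (T x e))\<^sup>2) \<le> (\<Sum>e\<in>UNIV. \<omega> (snd e) * (cmod (x e))\<^sup>2)"
    if "\<And>i. 0 < w i" "hs_adjoint \<Phi> (V ** real_diag w ** ctranspose V) = G ** real_diag \<omega> ** ctranspose G" for w \<omega> x
    using schwarz_map_trace_right[OF \<Phi> psd[of V w, OF unit(2) that(1)], of "Y x"]
    unfolding that(2) pair_sum_trace(1)[OF unit(1,2)] pair_sum_trace(1)[OF unit(3,4)] coord T_def[symmetric]
    by (simp add: less_eq_complex_def)
  have left: "(\<Sum>e\<in>UNIV. a (fst e) * (cmod (T x e))\<^sup>2) \<le> (\<Sum>e\<in>UNIV. \<alpha> (fst e) * (cmod (x e))\<^sup>2)" for x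
    using schwarz_map_trace_left[OF \<Phi> psd[of U a, OF unit(1) pos(1)], of "Y x"]
    unfolding A pair_sum_trace(2)[OF unit(1,2)] pair_sum_trace(2)[OF unit(3,4)] coord T_def[symmetric]
    by (simp add: less_eq_complex_def)
  have const: "(\<Sum>e\<in>UNIV. 1 * (cmod (T x e))\<^sup>2) \<le> (\<Sum>e\<in>UNIV. \<kappa> * (cmod (x e))\<^sup>2)" for x
    by (rule right) (simp_all add: unitary_conjugate_1 unit one cscale_mat_1_spectral)
  \<comment> \<open>For \<open>s = r = 0\<close> this is \<open>t = 0\<close>, and both identities for \<open>t\<close> below still hold.\<close>
  define t where "t = r / (s + r)"
  have t: "0 \<le> t" "t \<le> 1" using sr by (auto simp: t_def divide_le_eq)
  have "(s + r) * t = r" using sr by (cases "s + r = 0") (auto simp: t_def)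
  then have st: "(s + r) * (1 - t) = s" "(s + r) * t = r" by (simp_all add: right_diff_distrib)
  have edge: "(\<Sum>e\<in>UNIV. a (fst e) powr (1 - t) * z (snd e) powr t * (cmod (T x e))\<^sup>2)
      \<le> (\<Sum>e\<in>UNIV. \<alpha> (fst e) powr (1 - t) * \<zeta> (snd e) powr t * (cmod (x e))\<^sup>2)" for x
    by (rule weighted_interpolation[OF T_add _ _ _ _ left right[OF pos(2) Z] t]) (rule pos)+
  have "(\<Sum>e\<in>UNIV. 1 powr (1 - (s + r)) * (a (fst e) powr (1 - t) * z (snd e) powr t) powr (s + r) * (cmod (T x e))\<^sup>2)
      \<le> (\<Sum>e\<in>UNIV. \<kappa> powr (1 - (s + r)) * (\<alpha> (fst e) powr (1 - t) * \<zeta> (snd e) powr t) powr (s + r) * (cmod (x e))\<^sup>2)" for x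
    by (rule weighted_interpolation[OF T_add _ _ _ _ const edge])
       (use \<kappa> sr pos in \<open>auto intro!: mult_pos_pos simp: less_imp_neq[THEN not_sym]\<close>)
  moreover have "(u powr (1 - t) * v powr t) powr (s + r) = u powr s * v powr r" if "0 < u" "0 < v" for u v
    using that st by (simp add: powr_mult powr_powr mult.commute)
  ultimately have "(\<Sum>e\<in>UNIV. a (fst e) powr s * z (snd e) powr r * (cmod (T x e))\<^sup>2)
      \<le> \<kappa> powr (1 - s - r) * (\<Sum>e\<in>UNIV. \<alpha> (fst e) powr s * \<zeta> (snd e) powr r * (cmod (x e))\<^sup>2)" for x
    by (simp add: pos sum_distrib_left diff_diff_eq mult.assoc)
  from this[of "\<lambda>e. C $ fst e $ snd e"] show ?thesis by (simp add: T_def Y_def)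
qed

text \<open>
  Duality. Let \<open>N\<close> and \<open>M\<close> be the two traces, and let \<open>C\<close> be the matrix, in the eigenbases, of
  \<open>\<Psi>(A)\<^sup>-\<^sup>s \<Psi>(B) \<Psi>(Z)\<^sup>-\<^sup>r\<close>. Then \<open>N\<close> is the pairing of \<open>\<Psi>(B)\<close> with this matrix, that is, of \<open>B\<close>
  with its image under \<open>\<Phi>\<close>. The weighted arithmetic-geometric mean inequality and the previous lemma
  yield \<open>N \<le> R M / 2 + R N / (2 R)\<close> with \<open>R = \<kappa> powr (1 - s - r)\<close>.
\<close>

lemma hs_adjoint_trace_le:
  fixes \<Phi> :: "'m::finite cmat \<Rightarrow> 'n::finite cmat"
  assumes \<Phi>: "schwarz_map \<Phi>" and one: "hs_adjoint \<Phi> (mat 1) = cscale (complex_of_real \<kappa>) (mat 1)"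
    and \<kappa>: "0 < \<kappa>" and sr: "0 \<le> s" "0 \<le> r" "s + r \<le> 1"
    and A: "pos_def A" and Z: "pos_def Z"
  defines "\<Psi> \<equiv> hs_adjoint \<Phi>"
  shows "Re (trace (ctranspose (\<Psi> B) ** mat_powr (\<Psi> A) (- s) ** \<Psi> B ** mat_powr (\<Psi> Z) (- r)))
    \<le> \<kappa> powr (1 - s - r) * Re (trace (ctranspose B ** mat_powr A (- s) ** B ** mat_powr Z (- r)))"
proof -
  obtain U a where U: "unitary U" and a: "\<And>i. 0 < a i" and A_eq: "A = U ** real_diag a ** ctranspose U"
    using pos_def_spectral[OF A] by metis
  obtain V z where V: "unitary V" and z: "\<And>i. 0 < z i" and Z_eq: "Z = V ** real_diag z ** ctranspose V"
    using pos_def_spectral[OF Z] by metis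
  obtain E \<alpha> where E: "unitary E" and \<alpha>: "\<And>i. 0 < \<alpha> i" and \<Psi>A: "\<Psi> A = E ** real_diag \<alpha> ** ctranspose E"
    using pos_def_spectral[OF hs_adjoint_pos_def[OF \<Phi> one \<kappa> A]] unfolding \<Psi>_def by metis
  obtain G \<zeta> where G: "unitary G" and \<zeta>: "\<And>i. 0 < \<zeta> i" and \<Psi>Z: "\<Psi> Z = G ** real_diag \<zeta> ** ctranspose G"
    using pos_def_spectral[OF hs_adjoint_pos_def[OF \<Phi> one \<kappa> Z]] unfolding \<Psi>_def by metis
  define R where "R = \<kappa> powr (1 - s - r)"
  have R: "0 < R" using \<kappa> by (simp add: R_def)
  define b where "b e = (ctranspose U ** B ** V) $ fst e $ snd e" for e
  define \<beta> where "\<beta> e = (ctranspose E ** \<Psi> B ** G) $ fst e $ snd e" for e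
  define C where "C = (\<chi> k l. of_real (\<alpha> k powr - s * \<zeta> l powr - r) * \<beta> (k, l))"
  define c where "c e = (ctranspose U ** \<Phi> (E ** C ** ctranspose G) ** V) $ fst e $ snd e" for e
  define M where "M = (\<Sum>e\<in>UNIV. a (fst e) powr - s * z (snd e) powr - r * (cmod (b e))\<^sup>2)"
  define N where "N = (\<Sum>e\<in>UNIV. \<alpha> (fst e) powr - s * \<zeta> (snd e) powr - r * (cmod (\<beta> e))\<^sup>2)"
  have M: "trace (ctranspose B ** mat_powr A (- s) ** B ** mat_powr Z (- r)) = of_real M"
  proof -
    have "mat_powr A (- s) = U ** real_diag (\<lambda>i. a i powr - s) ** ctranspose U"
      unfolding A_eq by (intro mat_powr_spectral U less_imp_le a)
    moreover have "mat_powr Z (- r) = V ** real_diag (\<lambda>i. z i powr - r) ** ctranspose V"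
      unfolding Z_eq by (intro mat_powr_spectral V less_imp_le z)
    ultimately show ?thesis by (simp only: trace_weighted M_def b_def)
  qed
  have N: "trace (ctranspose (\<Psi> B) ** mat_powr (\<Psi> A) (- s) ** \<Psi> B ** mat_powr (\<Psi> Z) (- r)) = of_real N"
  proof -
    have "mat_powr (\<Psi> A) (- s) = E ** real_diag (\<lambda>i. \<alpha> i powr - s) ** ctranspose E"
      unfolding \<Psi>A by (intro mat_powr_spectral E less_imp_le \<alpha>)
    moreover have "mat_powr (\<Psi> Z) (- r) = G ** real_diag (\<lambda>i. \<zeta> i powr - r) ** ctranspose G"
      unfolding \<Psi>Z by (intro mat_powr_spectral G less_imp_le \<zeta>)
    ultimately show ?thesis by (simp only: trace_weighted N_def \<beta>_def)
  qed
  have C: "C $ fst e $ snd e = of_real (\<alpha> (fst e) powr - s * \<zeta> (snd e) powr - r) * \<beta> e" for e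
    by (simp add: C_def)
  have N_C: "(\<Sum>e\<in>UNIV. \<alpha> (fst e) powr s * \<zeta> (snd e) powr r * (cmod (C $ fst e $ snd e))\<^sup>2) = N"
  proof -
    have cancel: "u powr s * v powr r * (u powr - s * v powr - r)\<^sup>2 = u powr - s * v powr - r"
      if "0 < u" "0 < v" for u v :: real
    proof -
      have "0 < u powr s * v powr r" using that by simp
      moreover have "u powr - s * v powr - r = 1 / (u powr s * v powr r)"
        by (simp add: powr_minus_divide)
      ultimately show ?thesis by (simp add: power2_eq_square)
    qed
    show ?thesis
      unfolding N_def
    proof (rule sum.cong)
      fix e :: "'m \<times> 'm"
      define k where "k = \<alpha> (fst e) powr - s * \<zeta> (snd e) powr - r"
      have "\<alpha> (fst e) powr s * \<zeta> (snd e) powr r * k\<^sup>2 = k"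
        unfolding k_def by (rule cancel[OF \<alpha> \<zeta>])
      moreover have "(cmod (C $ fst e $ snd e))\<^sup>2 = k\<^sup>2 * (cmod (\<beta> e))\<^sup>2"
        unfolding C k_def[symmetric] norm_mult norm_of_real power_mult_distrib power2_abs ..
      ultimately show "\<alpha> (fst e) powr s * \<zeta> (snd e) powr r * (cmod (C $ fst e $ snd e))\<^sup>2
          = \<alpha> (fst e) powr - s * \<zeta> (snd e) powr - r * (cmod (\<beta> e))\<^sup>2"
        unfolding k_def[symmetric] by (simp only: mult.assoc[symmetric])
    qed simp
  qed
  have interp: "(\<Sum>e\<in>UNIV. a (fst e) powr s * z (snd e) powr r * (cmod (c e))\<^sup>2) \<le> R * N"
    unfolding R_def c_def N_C[symmetric]
    by (rule schwarz_map_weighted_interpolation[where a = a and z = z and \<alpha> = \<alpha> and \<zeta> = \<zeta>, OF \<Phi> one \<kappa> sr U V E G a z \<alpha> \<zeta>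
        \<Psi>A[unfolded \<Psi>_def A_eq] \<Psi>Z[unfolded \<Psi>_def Z_eq]])
  have "of_real N = hs_inner (\<Psi> B) (E ** C ** ctranspose G)"
  proof -
    have "ctranspose E ** (E ** C ** ctranspose G) ** G = (ctranspose E ** E) ** C ** (ctranspose G ** G)"
      by (simp only: matrix_mul_assoc)
    then have *: "ctranspose E ** (E ** C ** ctranspose G) ** G = C"
      using E G by (simp add: unitary_def)
    have "hs_inner (\<Psi> B) (E ** C ** ctranspose G) = (\<Sum>e\<in>UNIV. cnj (\<beta> e) * C $ fst e $ snd e)"
      by (subst hs_inner_unitary[OF E G, symmetric]) (simp add: * hs_inner_pairs \<beta>_def)
    then show ?thesis
      unfolding C N_def of_real_sum of_real_mult complex_norm_square by (simp add: mult_ac)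
  qed
  also have "\<dots> = hs_inner B (\<Phi> (E ** C ** ctranspose G))"
    by (simp add: \<Psi>_def schwarz_map_hs_adjoint[OF \<Phi>])
  also have "\<dots> = (\<Sum>e\<in>UNIV. cnj (b e) * c e)"
    by (subst hs_inner_unitary[OF U V, symmetric]) (simp add: hs_inner_pairs b_def c_def)
  finally have "N = Re (\<Sum>e\<in>UNIV. cnj (b e) * c e)" by (metis Re_complex_of_real)
  also have "\<dots> \<le> (\<Sum>e\<in>UNIV. cmod (b e) * cmod (c e))"
    unfolding Re_sum by (intro sum_mono order_trans[OF complex_Re_le_cmod]) (simp add: norm_mult)
  also have "\<dots> \<le> (\<Sum>e\<in>UNIV. R / 2 * (a (fst e) powr - s * z (snd e) powr - r * (cmod (b e))\<^sup>2)
      + 1 / (2 * R) * (a (fst e) powr s * z (snd e) powr r * (cmod (c e))\<^sup>2))"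
  proof (rule sum_mono)
    fix e :: "'n \<times> 'n"
    define w where "w = a (fst e) powr s * z (snd e) powr r"
    have w: "0 < w" using a[of "fst e"] z[of "snd e"] by (simp add: w_def)
    have winv: "a (fst e) powr - s * z (snd e) powr - r = 1 / w"
      by (simp add: w_def powr_minus_divide)
    have "0 \<le> (R * cmod (b e) - w * cmod (c e))\<^sup>2" by simp
    then have "cmod (b e) * cmod (c e) * (2 * R * w) \<le> R\<^sup>2 * (cmod (b e))\<^sup>2 + w\<^sup>2 * (cmod (c e))\<^sup>2"
      by (simp add: power2_diff power_mult_distrib mult_ac)
    then have "cmod (b e) * cmod (c e) \<le> (R\<^sup>2 * (cmod (b e))\<^sup>2 + w\<^sup>2 * (cmod (c e))\<^sup>2) / (2 * R * w)"
      using R w by (subst pos_le_divide_eq) auto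
    also have "\<dots> = R / 2 * (1 / w * (cmod (b e))\<^sup>2) + 1 / (2 * R) * (w * (cmod (c e))\<^sup>2)"
      using R w by (simp add: add_divide_distrib power2_eq_square)
    finally show "cmod (b e) * cmod (c e) \<le> R / 2 * (a (fst e) powr - s * z (snd e) powr - r * (cmod (b e))\<^sup>2)
      + 1 / (2 * R) * (a (fst e) powr s * z (snd e) powr r * (cmod (c e))\<^sup>2)"
      unfolding winv w_def[symmetric] by simp
  qed
  also have "\<dots> = R / 2 * M + 1 / (2 * R) * (\<Sum>e\<in>UNIV. a (fst e) powr s * z (snd e) powr r * (cmod (c e))\<^sup>2)"
    by (simp only: sum.distrib sum_distrib_left M_def)
  also have "\<dots> \<le> R / 2 * M + 1 / (2 * R) * (R * N)"
    using interp R by (intro add_left_mono mult_left_mono) auto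
  also have "1 / (2 * R) * (R * N) = N / 2" using R by simp
  finally have "N \<le> R * M" by simp
  then show ?thesis unfolding M N R_def by simp
qed

section \<open>A variational formula\<close>

text \<open>
  Young's inequality for \<open>d e\<^sup>-\<^sup>r\<close> and \<open>e\<close> with exponents \<open>q\<close> and \<open>1 - q\<close>, where \<open>r = (1 - q) / q\<close>
  is chosen such that the powers of \<open>e\<close> cancel.
\<close>

lemma powr_le_weighted_sum:
  fixes d e q :: real
  assumes "0 \<le> d" "0 < e" "0 < q" "q < 1"
  shows "d powr q \<le> q * (d * e powr - ((1 - q) / q)) + (1 - q) * e"
proof (cases "d = 0")
  case False
  have "(d * e powr - ((1 - q) / q)) powr q * e powr (1 - q) = d powr q * (e powr (- (1 - q)) * e powr (1 - q))"
    using assms by (simp add: powr_mult powr_powr)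
  also have "\<dots> = d powr q" using assms by (simp add: powr_add[symmetric])
  finally show ?thesis
    using Youngs_inequality_0[of q "1 - q" "d * e powr - ((1 - q) / q)" e] assms False by simp
qed (use assms in simp)

text \<open>
  The squared moduli of the entries of the unitary that relates the two eigenbases turn every trace
  into an average of scalars, one eigenvalue from each matrix, so the scalar inequality can be
  applied termwise.
\<close>

lemma trace_powr_variational:
  fixes X Z :: "'n::finite cmat"
  assumes X: "pos_semidef X" and Z: "pos_def Z" and q: "0 < q" "q < 1"
  shows "Re (trace (mat_powr X q)) \<le> q * Re (trace (X ** mat_powr Z (- ((1 - q) / q)))) + (1 - q) * Re (trace Z)"
proof -
  obtain W x where W: "unitary W" and x: "\<And>i. 0 \<le> x i" and X_eq: "X = W ** real_diag x ** ctranspose W"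
    using pos_semidef_spectral[OF X] by metis
  obtain V z where V: "unitary V" and z: "\<And>i. 0 < z i" and Z_eq: "Z = V ** real_diag z ** ctranspose V"
    using pos_def_spectral[OF Z] by metis
  define m where "m e = (cmod ((ctranspose W ** V) $ fst e $ snd e))\<^sup>2" for e
  have tr: "Re (trace ((W ** real_diag f ** ctranspose W) ** (V ** real_diag g ** ctranspose V)))
      = (\<Sum>e\<in>UNIV. f (fst e) * g (snd e) * m e)" for f g
    using trace_weighted[of "mat 1" W f V g] by (simp add: m_def)
  have "Re (trace (mat_powr X q)) = (\<Sum>e\<in>UNIV. x (fst e) powr q * m e)"
    using tr[of "\<lambda>i. x i powr q" "\<lambda>_. 1"] by (simp add: X_eq mat_powr_spectral W x unitary_conjugate_1 V)
  also have "\<dots> \<le> (\<Sum>e\<in>UNIV. (q * (x (fst e) * z (snd e) powr - ((1 - q) / q)) + (1 - q) * z (snd e)) * m e)"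
    by (intro sum_mono mult_right_mono powr_le_weighted_sum x z q) (simp add: m_def)
  also have "\<dots> = q * (\<Sum>e\<in>UNIV. x (fst e) * z (snd e) powr - ((1 - q) / q) * m e) + (1 - q) * (\<Sum>e\<in>UNIV. 1 * z (snd e) * m e)"
    unfolding sum_distrib_left sum.distrib[symmetric] by (intro sum.cong) (auto simp: algebra_simps)
  also have "\<dots> = q * Re (trace (X ** mat_powr Z (- ((1 - q) / q)))) + (1 - q) * Re (trace Z)"
    using tr[of x "\<lambda>j. z j powr - ((1 - q) / q)"] tr[of "\<lambda>_. 1" z] W V z
    by (simp add: X_eq Z_eq mat_powr_spectral unitary_conjugate_1 less_imp_le)
  finally show ?thesis .
qed

lemma trace_mat_powr_real:
  assumes "pos_semidef X"
  shows "Im (trace (mat_powr X q)) = 0"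
proof -
  obtain W x where "unitary W" "\<And>i. 0 \<le> x i" "X = W ** real_diag x ** ctranspose W"
    using pos_semidef_spectral[OF assms] by metis
  then show ?thesis by (simp add: mat_powr_spectral trace_unitary_conjugate)
qed

lemma pos_def_mat_powr:
  assumes "pos_def X"
  shows "pos_def (mat_powr X p)"
proof -
  obtain W x where W: "unitary W" and x: "\<And>i. 0 < x i" and X: "X = W ** real_diag x ** ctranspose W"
    using pos_def_spectral[OF assms] by metis
  have "0 < x i powr p" for i using x[of i] by simp
  then show ?thesis
    using W x by (simp add: X mat_powr_spectral less_imp_le pos_def_of_spectral)
qed

theorem theorem4p5:
  fixes \<Phi> :: "'m::finite cmat \<Rightarrow> 'n::finite cmat"
    and A B :: "'n cmat"
    and s q :: real
  assumes "0 \<le> s" and "s < 1"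
    and "schwarz_map \<Phi>" and "sesquiunital \<Phi>"
    and "pos_def A" and "invertible B"
    and "1 / (2 - s) \<le> q" and "q < 1"
  shows "complex_of_real ((real CARD('n) / real CARD('m)) powr ((2 - s) * q - 1))
           * trace (mat_powr (ctranspose B ** mat_powr A (- s) ** B) q)
         \<ge> trace (mat_powr (ctranspose (hs_adjoint \<Phi> B) ** mat_powr (hs_adjoint \<Phi> A) (- s)
                    ** hs_adjoint \<Phi> B) q)"
proof -
  note \<Phi> = \<open>schwarz_map \<Phi>\<close>
  define \<kappa> where "\<kappa> = real CARD('n) / real CARD('m)"
  have \<kappa>: "0 < \<kappa>" by (simp add: \<kappa>_def)
  have one: "hs_adjoint \<Phi> (mat 1) = cscale (complex_of_real \<kappa>) (mat 1)"
    and unit: "\<Phi> (mat 1) = mat 1"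
    using \<open>sesquiunital \<Phi>\<close> by (auto simp: sesquiunital_def semiunital_def unital_def \<kappa>_def)
  have "0 < 1 / (2 - s)" using \<open>s < 1\<close> by simp
  then have q: "0 < q" "q < 1" using assms by linarith+
  define r where "r = (1 - q) / q"
  have r: "0 \<le> r" "s + r \<le> 1" "q * r = 1 - q"
    using q assms by (auto simp: r_def field_simps)
  define X where "X = ctranspose B ** mat_powr A (- s) ** B"
  define X' where "X' = ctranspose (hs_adjoint \<Phi> B) ** mat_powr (hs_adjoint \<Phi> A) (- s) ** hs_adjoint \<Phi> B"
  have X: "pos_def X" unfolding X_def by (intro pos_def_conjugate pos_def_mat_powr assms)
  have X': "pos_semidef X'" unfolding X'_def
    by (intro pos_semidef_conjugate pos_def_imp_pos_semidef pos_def_mat_powr hs_adjoint_pos_def[OF \<Phi> one \<kappa>] assms)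
  obtain W x where W: "unitary W" and x: "\<And>i. 0 < x i" and X_eq: "X = W ** real_diag x ** ctranspose W"
    using pos_def_spectral[OF X] by metis
  define c where "c = \<kappa> powr (1 - s - r)"
  have c: "0 < c" using \<kappa> by (simp add: c_def)
  define S where "S = (\<Sum>i\<in>UNIV. x i powr q)"
  \<comment> \<open>The optimiser \<open>X\<^sup>q\<close> of the variational formula for \<open>X\<close>, scaled by the factor \<open>c\<^sup>q\<close>
    that makes the two summands combine.\<close>
  define Z where "Z = W ** real_diag (\<lambda>i. c powr q * x i powr q) ** ctranspose W"
  have z: "0 < c powr q * x i powr q" for i using c x[of i] by simp
  have Z: "pos_def Z" unfolding Z_def by (intro pos_def_of_spectral W z)
  have XZ: "trace (X ** mat_powr Z (- r)) = of_real (c powr (- q * r) * S)"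
  proof -
    have "x i * (c powr q * x i powr q) powr - r = c powr (- q * r) * x i powr q" for i
    proof -
      have "x i * x i powr (- q * r) = x i powr q"
        using powr_add[of "x i" 1 "- q * r"] x[of i] r(3) by simp
      then show ?thesis using c x[of i] by (simp add: powr_mult powr_powr mult_ac)
    qed
    then show ?thesis
      using z W unfolding X_eq Z_def S_def
      by (simp add: mat_powr_spectral less_imp_le unitary_conjugate_mult real_diag_mult
          trace_unitary_conjugate sum_distrib_left del: of_real_mult of_real_sum)
  qed
  have trZ: "trace Z = of_real (c powr q * S)"
    unfolding Z_def S_def trace_unitary_conjugate[OF W] by (simp add: sum_distrib_left)
  have "trace (hs_adjoint \<Phi> Z) = hs_inner (hs_adjoint \<Phi> Z) (mat 1)"
    by (subst hs_inner_hermitian)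
       (simp_all add: pos_semidef_hermitian pos_def_imp_pos_semidef hs_adjoint_pos_def[OF \<Phi> one \<kappa> Z])
  also have "\<dots> = trace Z"
    by (simp add: schwarz_map_hs_adjoint[OF \<Phi>] unit hs_inner_hermitian pos_semidef_hermitian
        pos_def_imp_pos_semidef Z)
  finally have tr\<Psi>Z: "trace (hs_adjoint \<Phi> Z) = trace Z" .
  have "Re (trace (mat_powr X' q)) \<le> q * Re (trace (X' ** mat_powr (hs_adjoint \<Phi> Z) (- r))) + (1 - q) * Re (trace (hs_adjoint \<Phi> Z))"
    unfolding r_def by (rule trace_powr_variational[OF X' hs_adjoint_pos_def[OF \<Phi> one \<kappa> Z] q])
  also have "\<dots> \<le> q * (c * Re (trace (X ** mat_powr Z (- r)))) + (1 - q) * Re (trace Z)"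
    unfolding X'_def X_def c_def tr\<Psi>Z using q r assms
    by (intro add_right_mono mult_left_mono hs_adjoint_trace_le \<Phi> one \<kappa> Z) auto
  also have "\<dots> = q * (c * c powr (- q * r)) * S + (1 - q) * (c powr q * S)"
    by (simp add: XZ trZ)
  also have "c * c powr (- q * r) = c powr q"
    using powr_add[of c 1 "- q * r"] c r(3) by simp
  also have "q * c powr q * S + (1 - q) * (c powr q * S) = c powr q * S"
    by (simp add: algebra_simps)
  also have "c powr q = \<kappa> powr ((2 - s) * q - 1)"
  proof -
    have "(1 - s - r) * q = (2 - s) * q - 1" using r(3) by (simp add: algebra_simps)
    then show ?thesis by (simp add: c_def powr_powr)
  qed
  also have "complex_of_real S = trace (mat_powr X q)"
    unfolding X_eq S_def using W x by (simp add: mat_powr_spectral trace_unitary_conjugate less_imp_le)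
  then have "S = Re (trace (mat_powr X q))" by (metis Re_complex_of_real)
  finally show ?thesis
    using trace_mat_powr_real[OF X', of q] trace_mat_powr_real[OF pos_def_imp_pos_semidef[OF X], of q]
    unfolding less_eq_complex_def X_def[symmetric] X'_def[symmetric] \<kappa>_def[symmetric] by simp
qed

end
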